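(* Let $t>0$ and let $G\in\mathscr{M}_t$. Let $s$ be the number of universal vertices of $G$, and let $G_1,\dots,G_r$ be the connected components of the graph obtained from $G$ by deleting its universal vertices. Then $G = K_s \ast (G_1\sqcup\cdots\sqcup G_r)$, this decomposition is unique, and each $G_j$ is either a complete graph or satisfies $G_j\in\mathscr{N}_{t_j}$ for some $t_j>0$, where $t_j=\check{\mu}(G_j)$ (so $t_j=0$ when $G_j$ is complete). Furthermore $$t=\sum_{j=1}^r t_j+\sum_{j=1}^r i_H(G_j)-s.$$
   Context: All graphs are finite and simple with nonempty vertex set. By convention the complete graphs $K_1$ and $K_2$ are regarded as Hamiltonian (in addition to graphs with a Hamiltonian cycle). $G\sqcup H$ denotes the disjoint union of graphs and $G\ast H$ their join, i.e. $G\sqcup H$ together with all edges $vw$ with $v\in V(G)$, $w\in V(H)$; $K_0$ is the empty graph, so $K_0\ast G=G$. A vertex $v$ of $G$ is universal if $\deg(v)=|V(G)|-1$. For a graph $G$: $\check{\mu}(G)=\min\{l\in\mathbb{N}_0 : K_l\ast G \text{ is Hamiltonian}\}$; $i_H(G)=1$ if $G$ is Hamiltonian and $0$ otherwise. For $t\ge 0$, $\mathscr{M}_t$ is the set of graphs $G$ with $\check{\mu}(G)=t$ and $\check{\mu}(G+e)<t$ for every edge $e$ of the complement $\overline{G}$ (i.e. every non-edge of $G$). For $t\ge1$, $\mathscr{N}_t$ is the set of graphs in $\mathscr{M}_t$ that are connected and have no universal vertex. *)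

theory Defs
  imports "Graph_Theory.Graph_Theory"
begin

text \<open>
  Finite simple graphs are represented as finite, symmetric, loop-free digraphs without
  parallel arcs (\<^locale>\<open>pair_graph\<close>): an edge \<open>uv\<close> is the pair of arcs \<open>(u,v)\<close>, \<open>(v,u)\<close>.
\<close>

definition simple_graph :: "'a pair_pre_digraph \<Rightarrow> bool" where
  "simple_graph G \<longleftrightarrow> pair_graph G \<and> pverts G \<noteq> {}"

definition complete_graph :: "'a pair_pre_digraph \<Rightarrow> bool" where
  "complete_graph G \<longleftrightarrow> (\<exists>n>0. complete_digraph n (with_proj G))"

definition K_graph :: "nat \<Rightarrow> nat pair_pre_digraph" where
  "K_graph l = \<lparr> pverts = {..<l}, parcs = {(i, j). i < l \<and> j < l \<and> i \<noteq> j} \<rparr>"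

definition graph_join :: "'a pair_pre_digraph \<Rightarrow> 'b pair_pre_digraph \<Rightarrow> ('a + 'b) pair_pre_digraph" where
  "graph_join G H = \<lparr>
     pverts = pverts G <+> pverts H,
     parcs = map_prod Inl Inl ` parcs G \<union> map_prod Inr Inr ` parcs H
       \<union> (Inl ` pverts G) \<times> (Inr ` pverts H) \<union> (Inr ` pverts H) \<times> (Inl ` pverts G) \<rparr>"

definition disjoint_union :: "'i set \<Rightarrow> ('i \<Rightarrow> 'a pair_pre_digraph) \<Rightarrow> ('i \<times> 'a) pair_pre_digraph" where
  "disjoint_union I H = \<lparr>
     pverts = (SIGMA i:I. pverts (H i)),
     parcs = (\<Union>i\<in>I. map_prod (Pair i) (Pair i) ` parcs (H i)) \<rparr>"

definition map_graph :: "('a \<Rightarrow> 'b) \<Rightarrow> 'a pair_pre_digraph \<Rightarrow> 'b pair_pre_digraph" where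
  "map_graph f G = \<lparr> pverts = f ` pverts G, parcs = map_prod f f ` parcs G \<rparr>"

definition graph_iso :: "('a \<Rightarrow> 'b) \<Rightarrow> 'a pair_pre_digraph \<Rightarrow> 'b pair_pre_digraph \<Rightarrow> bool" where
  "graph_iso f G H \<longleftrightarrow> inj_on f (pverts G) \<and> map_graph f G = H"

definition add_edge :: "'a pair_pre_digraph \<Rightarrow> 'a \<Rightarrow> 'a \<Rightarrow> 'a pair_pre_digraph" where
  "add_edge G u v = \<lparr> pverts = pverts G, parcs = parcs G \<union> {(u, v), (v, u)} \<rparr>"

definition del_verts :: "'a pair_pre_digraph \<Rightarrow> 'a set \<Rightarrow> 'a pair_pre_digraph" where
  "del_verts G S = \<lparr> pverts = pverts G - S, parcs = parcs G \<inter> (pverts G - S) \<times> (pverts G - S) \<rparr>"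

text \<open>
  In a symmetric digraph the strongly connected components are the connected components
  of the undirected graph.
\<close>
definition components :: "'a pair_pre_digraph \<Rightarrow> 'a pair_pre_digraph set" where
  "components G = {H. with_proj H \<in> pre_digraph.sccs (with_proj G)}"

definition universal_verts :: "'a pair_pre_digraph \<Rightarrow> 'a set" where
  "universal_verts G = {v \<in> pverts G. out_degree (with_proj G) v = card (pverts G) - 1}"

text \<open>
  The bound on the length excludes the closed walk \<open>u, v, u\<close> along a single edge, which is a
  directed cycle. The graphs \<open>K\<^sub>1\<close> and \<open>K\<^sub>2\<close> are Hamiltonian by convention.
\<close>
definition hamiltonian :: "'a pair_pre_digraph \<Rightarrow> bool" where
  "hamiltonian G \<longleftrightarrow>
     complete_digraph 1 (with_proj G) \<or> complete_digraph 2 (with_proj G) \<or>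
     (\<exists>p. pre_digraph.cycle (with_proj G) p \<and> 3 \<le> length p \<and> fst ` set p = pverts G)"

definition mu :: "'a pair_pre_digraph \<Rightarrow> nat" where
  "mu G = (LEAST l. hamiltonian (graph_join (K_graph l) G))"

definition i_H :: "'a pair_pre_digraph \<Rightarrow> nat" where
  "i_H G = (if hamiltonian G then 1 else 0)"

definition M_class :: "nat \<Rightarrow> 'a pair_pre_digraph set" where
  "M_class t = {G. simple_graph G \<and> mu G = t \<and>
     (\<forall>u\<in>pverts G. \<forall>v\<in>pverts G. u \<noteq> v \<and> (u, v) \<notin> parcs G \<longrightarrow> mu (add_edge G u v) < t)}"

definition N_class :: "nat \<Rightarrow> 'a pair_pre_digraph set" where
  "N_class t = {G \<in> M_class t.
     Digraph_Component.connected (with_proj G) \<and> universal_verts G = {}}"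

end

theory Submission
  imports Defs
begin

text \<open>
  Let \<open>\<pi>(G)\<close> be the least number of disjoint paths covering \<open>G\<close>. A Hamiltonian cycle of \<open>K\<^sub>l * G\<close> with
  \<open>l > 0\<close> becomes at most \<open>l\<close> paths on deleting \<open>K\<^sub>l\<close>, and conversely \<open>l\<close> vertices close up \<open>l\<close> paths;
  hence \<open>mu G + i_H G = \<pi>(G)\<close>. The number \<open>\<pi>\<close> is additive over components, and a universal vertex lowers
  it by exactly one as long as it stays positive. So if \<open>G \<in> M_class t\<close> has \<open>s\<close> universal vertices and
  \<open>D\<close> is what remains without them, then \<open>\<pi>(D) = t + s\<close>, which is the formula for \<open>t\<close>. If
  \<open>\<pi>(D) \<ge> 2\<close>, the criticality of \<open>G\<close> says that every new edge lowers \<open>\<pi>(D)\<close>, and by additivity the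
  components inherit this; otherwise \<open>D = G\<close> is connected. An incomplete component has no universal vertex
  \<open>v\<close>, because joining \<open>v\<close> to another component would not lower \<open>\<pi>(D)\<close>.
\<close>

section \<open>Path covers\<close>

text \<open>For a nonempty list this is one plus the number of gaps, that is, of consecutive
  non-adjacent pairs. The value 0 at \<open>[]\<close> makes the empty set need no path.\<close>

fun num_paths :: "'a rel \<Rightarrow> 'a list \<Rightarrow> nat" where
  "num_paths E [] = 0"
| "num_paths E [x] = 1"
| "num_paths E (x # y # zs) = of_bool ((x, y) \<notin> E) + num_paths E (y # zs)"

text \<open>
  A covering of \<open>V\<close> by \<open>k\<close> disjoint paths is encoded as an enumeration of \<open>V\<close>: concatenate the
  paths, and cut the list wherever consecutive vertices are not adjacent.
\<close>

definition path_cover :: "'a rel \<Rightarrow> 'a set \<Rightarrow> nat \<Rightarrow> bool" where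
  "path_cover E V k \<longleftrightarrow> (\<exists>xs. distinct xs \<and> set xs = V \<and> num_paths E xs \<le> k)"

definition path_number :: "'a rel \<Rightarrow> 'a set \<Rightarrow> nat" where
  "path_number E V = (LEAST k. path_cover E V k)"

text \<open>
  In a loop-free symmetric graph the list \<open>[u, v]\<close> is a cycle iff \<open>u\<close> and \<open>v\<close> are adjacent, so only
  \<open>K\<^sub>1\<close> needs separate treatment here.
\<close>

definition ham :: "'a rel \<Rightarrow> 'a set \<Rightarrow> bool" where
  "ham E V \<longleftrightarrow> card V = 1 \<or>
     (\<exists>xs. distinct xs \<and> set xs = V \<and> xs \<noteq> [] \<and> successively (\<lambda>x y. (x, y) \<in> E) (xs @ [hd xs]))"

lemma num_paths_Cons:
  "num_paths E (x # xs) = (if xs = [] then 1 else of_bool ((x, hd xs) \<notin> E) + num_paths E xs)"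
  by (cases xs) auto

lemma num_paths_pos: "xs \<noteq> [] \<Longrightarrow> num_paths E xs > 0"
  by (induction xs) (auto simp: num_paths_Cons)

lemma num_paths_Cons_ge: "num_paths E xs \<le> num_paths E (x # xs)"
  by (auto simp: num_paths_Cons)

lemma num_paths_Cons_le: "num_paths E (x # xs) \<le> Suc (num_paths E xs)"
  by (auto simp: num_paths_Cons)

text \<open>The junction is a gap unless it is an edge, in which case two paths merge. The edge term
  stands on the left so that no subtraction of naturals occurs.\<close>

lemma num_paths_append:
  "xs \<noteq> [] \<Longrightarrow> ys \<noteq> [] \<Longrightarrow>
    num_paths E (xs @ ys) + of_bool ((last xs, hd ys) \<in> E) = num_paths E xs + num_paths E ys"
  by (induction xs) (auto simp: num_paths_Cons)

lemma num_paths_append_le: "num_paths E (xs @ ys) \<le> num_paths E xs + num_paths E ys"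
  using num_paths_append[of xs ys E] by (cases "xs = [] \<or> ys = []") auto

lemma num_paths_append_ge: "num_paths E xs + num_paths E ys \<le> Suc (num_paths E (xs @ ys))"
  using num_paths_append[of xs ys E]
  by (cases "xs = [] \<or> ys = []") (auto simp: of_bool_def split: if_splits)

lemma num_paths_map:
  "(\<And>x y. x \<in> set xs \<Longrightarrow> y \<in> set xs \<Longrightarrow> (f x, f y) \<in> F \<longleftrightarrow> (x, y) \<in> E) \<Longrightarrow>
    num_paths F (map f xs) = num_paths E xs"
  by (induction xs) (auto simp: num_paths_Cons hd_map)

text \<open>A nonempty list without gaps is a single path. The bound instead of an equation admits
  \<open>[]\<close>, and it lets walks inherit the counting lemmas.\<close>

lemma num_paths_le_1_iff: "num_paths E xs \<le> 1 \<longleftrightarrow> successively (\<lambda>x y. (x, y) \<in> E) xs"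
proof (induction xs)
  case (Cons x xs)
  then show ?case
    using num_paths_pos[of xs E] by (auto simp: num_paths_Cons successively_Cons)
qed auto

lemma path_cover_mono: "path_cover E V k \<Longrightarrow> k \<le> l \<Longrightarrow> path_cover E V l"
  unfolding path_cover_def by (metis le_trans)

text \<open>Every enumeration of a finite set is a cover of some size, so the least size is
  attained; larger bounds only weaken the condition.\<close>

lemma path_cover_iff: "finite V \<Longrightarrow> path_cover E V k \<longleftrightarrow> path_number E V \<le> k"
proof
  assume fin: "finite V"
  then have "\<exists>k. path_cover E V k"
    unfolding path_cover_def using finite_distinct_list by blast
  then have "path_cover E V (path_number E V)"
    unfolding path_number_def by (rule LeastI_ex)
  then show "path_number E V \<le> k \<Longrightarrow> path_cover E V k" by (rule path_cover_mono)
qed (auto simp: path_number_def intro: Least_le)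

section \<open>Invariance under injective maps\<close>

lemma path_cover_image_imp:
  assumes "inj_on f V" "\<And>x y. x \<in> V \<Longrightarrow> y \<in> V \<Longrightarrow> (f x, f y) \<in> F \<longleftrightarrow> (x, y) \<in> E"
    and "path_cover E V k"
  shows "path_cover F (f ` V) k"
proof -
  obtain xs where "distinct xs" "set xs = V" "num_paths E xs \<le> k"
    using assms(3) unfolding path_cover_def by blast
  then show ?thesis
    unfolding path_cover_def using assms(1,2) num_paths_map[of xs f F E]
    by (intro exI[of _ "map f xs"]) (auto simp: distinct_map)
qed

text \<open>The converse is the forward direction for the inverse of \<open>f\<close> on
  \<open>V\<close>. This serves the copy of a graph under \<open>Inr\<close> in a join and, with
  \<open>f\<close> the identity, two relations that agree on \<open>V\<close>.\<close>

lemma path_cover_image: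
  assumes "inj_on f V" "\<And>x y. x \<in> V \<Longrightarrow> y \<in> V \<Longrightarrow> (f x, f y) \<in> F \<longleftrightarrow> (x, y) \<in> E"
  shows "path_cover F (f ` V) k \<longleftrightarrow> path_cover E V k"
proof
  assume "path_cover F (f ` V) k"
  then have "path_cover E (inv_into V f ` f ` V) k"
    by (rule path_cover_image_imp[rotated 2]) (use assms in \<open>auto intro: inj_on_inv_into\<close>)
  then show "path_cover E V k" using assms(1) by simp
qed (rule path_cover_image_imp[OF assms])

lemma ham_image_imp:
  assumes "inj_on f V" "\<And>x y. x \<in> V \<Longrightarrow> y \<in> V \<Longrightarrow> (f x, f y) \<in> F \<longleftrightarrow> (x, y) \<in> E"
    and "ham E V"
  shows "ham F (f ` V)"
proof -
  consider "card V = 1" | xs where "distinct xs" "set xs = V" "xs \<noteq> []"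
      "successively (\<lambda>x y. (x, y) \<in> E) (xs @ [hd xs])"
    using assms(3) unfolding ham_def by blast
  then show ?thesis
  proof cases
    case 1
    then show ?thesis using assms(1) by (simp add: ham_def card_image)
  next
    case (2 xs)
    \<comment> \<open>The list with its first vertex repeated is not distinct, but
      \<open>num_paths\<close> only looks at gaps, so the whole cycle is transported at
      once.\<close>
    have "num_paths F (map f (xs @ [hd xs])) = num_paths E (xs @ [hd xs])"
      by (rule num_paths_map) (use 2 assms(2) in auto)
    then have "successively (\<lambda>x y. (x, y) \<in> F) (map f (xs @ [hd xs]))"
      using 2(4) unfolding num_paths_le_1_iff[symmetric] by simp
    then show ?thesis
      unfolding ham_def using 2 assms(1)
      by (intro disjI2 exI[of _ "map f xs"]) (auto simp: distinct_map hd_map)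
  qed
qed

lemma ham_image:
  assumes "inj_on f V" "\<And>x y. x \<in> V \<Longrightarrow> y \<in> V \<Longrightarrow> (f x, f y) \<in> F \<longleftrightarrow> (x, y) \<in> E"
  shows "ham F (f ` V) \<longleftrightarrow> ham E V"
proof
  assume "ham F (f ` V)"
  then have "ham E (inv_into V f ` f ` V)"
    by (rule ham_image_imp[rotated 2]) (use assms in \<open>auto intro: inj_on_inv_into\<close>)
  then show "ham E V" using assms(1) by simp
qed (rule ham_image_imp[OF assms])

lemma path_number_cong:
  assumes "\<And>x y. x \<in> V \<Longrightarrow> y \<in> V \<Longrightarrow> (x, y) \<in> E \<longleftrightarrow> (x, y) \<in> F"
  shows "path_number E V = path_number F V"
proof -
  have "path_cover F V k \<longleftrightarrow> path_cover E V k" for k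
    using path_cover_image[of "\<lambda>x. x" V F E k] assms by auto
  then show ?thesis by (simp add: path_number_def)
qed

lemma path_number_pos: "finite V \<Longrightarrow> V \<noteq> {} \<Longrightarrow> path_number E V > 0"
  using path_cover_iff[of V E 0] num_paths_pos[of _ E] unfolding path_cover_def
  by (metis gr0I le_zero_eq less_numeral_extra(3) set_empty)

lemma path_number_empty [simp]: "path_number E {} = 0"
  using path_cover_iff[of "{}" E 0] by (auto simp: path_cover_def)

section \<open>Additivity over sets without edges between them\<close>

lemma num_paths_filter:
  assumes "\<And>x y. x \<in> set xs \<Longrightarrow> y \<in> set xs \<Longrightarrow> P x \<noteq> P y \<Longrightarrow> (x, y) \<notin> E"
  shows "num_paths E (filter P xs) + num_paths E (filter (\<lambda>x. \<not> P x) xs) \<le> num_paths E xs"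
  using assms
proof (induction E xs rule: num_paths.induct)
  case (3 E x y zs)
  have IH: "num_paths E (filter P (y # zs)) + num_paths E (filter (\<lambda>x. \<not> P x) (y # zs))
      \<le> num_paths E (y # zs)"
    by (rule "3.IH") (use "3.prems" in auto)
  show ?case
  proof (cases "P x = P y")
    case True
    then show ?thesis using IH by auto
  next
    \<comment> \<open>Here \<open>x\<close> may open a new path in its own sublist, but the gap
      between \<open>x\<close> and \<open>y\<close> is counted in the whole list and pays for
      it.\<close>
    case False
    then have "(x, y) \<notin> E" using "3.prems" by auto
    then show ?thesis
      using IH False num_paths_Cons_le[of E x "filter P zs"]
        num_paths_Cons_le[of E x "filter (\<lambda>x. \<not> P x) zs"] by auto
  qed
qed auto

text \<open>Concatenating optimal enumerations gives one inequality; filtering an optimal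
  enumeration of the union into its two parts gives the other.\<close>

lemma path_number_Un:
  assumes "finite A" "finite B" "A \<inter> B = {}"
    and "\<And>a b. a \<in> A \<Longrightarrow> b \<in> B \<Longrightarrow> (a, b) \<notin> E \<and> (b, a) \<notin> E"
  shows "path_number E (A \<union> B) = path_number E A + path_number E B"
proof (rule antisym)
  obtain xs ys where xs: "distinct xs" "set xs = A" "num_paths E xs \<le> path_number E A"
    and ys: "distinct ys" "set ys = B" "num_paths E ys \<le> path_number E B"
    using path_cover_iff[of A E "path_number E A"] path_cover_iff[of B E "path_number E B"] assms
    unfolding path_cover_def by auto
  have "path_cover E (A \<union> B) (path_number E A + path_number E B)"
    unfolding path_cover_def
    using xs ys assms(3) num_paths_append_le[of E xs ys] by (intro exI[of _ "xs @ ys"]) auto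
  then show "path_number E (A \<union> B) \<le> path_number E A + path_number E B"
    using assms by (simp add: path_cover_iff)
next
  obtain xs where xs: "distinct xs" "set xs = A \<union> B" "num_paths E xs \<le> path_number E (A \<union> B)"
    using path_cover_iff[of "A \<union> B" E "path_number E (A \<union> B)"] assms
    unfolding path_cover_def by auto
  have "path_cover E A (num_paths E (filter (\<lambda>x. x \<in> A) xs))"
    unfolding path_cover_def using xs by (intro exI[of _ "filter (\<lambda>x. x \<in> A) xs"]) auto
  moreover have "path_cover E B (num_paths E (filter (\<lambda>x. x \<notin> A) xs))"
    unfolding path_cover_def using xs assms(3)
    by (intro exI[of _ "filter (\<lambda>x. x \<notin> A) xs"]) auto
  moreover have "num_paths E (filter (\<lambda>x. x \<in> A) xs) + num_paths E (filter (\<lambda>x. x \<notin> A) xs)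
      \<le> num_paths E xs"
    by (rule num_paths_filter) (use xs assms in auto)
  ultimately show "path_number E A + path_number E B \<le> path_number E (A \<union> B)"
    using assms xs(3) by (simp add: path_cover_iff)
qed

lemma path_number_UN:
  assumes "finite I" "\<And>i. i \<in> I \<Longrightarrow> finite (A i)"
    and "\<And>i j. i \<in> I \<Longrightarrow> j \<in> I \<Longrightarrow> i \<noteq> j \<Longrightarrow> A i \<inter> A j = {}"
    and "\<And>i j a b. i \<in> I \<Longrightarrow> j \<in> I \<Longrightarrow> i \<noteq> j \<Longrightarrow> a \<in> A i \<Longrightarrow> b \<in> A j \<Longrightarrow> (a, b) \<notin> E"
  shows "path_number E (\<Union>i\<in>I. A i) = (\<Sum>i\<in>I. path_number E (A i))"
  using assms
proof (induction I rule: finite_induct)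
  case (insert i I)
  have "path_number E (A i \<union> (\<Union>j\<in>I. A j)) = path_number E (A i) + path_number E (\<Union>j\<in>I. A j)"
  proof (rule path_number_Un)
    show "finite (A i)" "finite (\<Union>j\<in>I. A j)" using insert.hyps(1) insert.prems(1) by auto
    show "A i \<inter> (\<Union>j\<in>I. A j) = {}" using insert.hyps(2) insert.prems(2) by blast
    show "(a, b) \<notin> E \<and> (b, a) \<notin> E" if "a \<in> A i" "b \<in> (\<Union>j\<in>I. A j)" for a b
      using that insert.hyps(2) insert.prems(3) by blast
  qed
  moreover have "path_number E (\<Union>j\<in>I. A j) = (\<Sum>j\<in>I. path_number E (A j))"
    by (rule insert.IH)
      (use insert.prems(1) in blast, use insert.prems(2) in blast, use insert.prems(3) in blast)
  ultimately show ?case using insert.hyps by simp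
qed simp

section \<open>Deleting and adding vertices\<close>

lemma path_cover_delete:
  assumes "path_cover E (insert v W) k" "v \<notin> W"
  shows "path_cover E W (Suc k)"
proof -
  obtain xs where xs: "distinct xs" "set xs = insert v W" "num_paths E xs \<le> k"
    using assms unfolding path_cover_def by blast
  then obtain as bs where split: "xs = as @ v # bs" by (metis insertI1 split_list)
  \<comment> \<open>Splitting before \<open>v\<close> costs at most one path; dropping
    \<open>v\<close> from the front of \<open>v # bs\<close> and concatenating again costs
    none.\<close>
  have "num_paths E (as @ bs) \<le> Suc k"
    using num_paths_append_le[of E as bs] num_paths_append_ge[of E as "v # bs"]
      num_paths_Cons_ge[of E bs v] xs(3) split by simp
  then show ?thesis
    unfolding path_cover_def using xs split assms(2) by (intro exI[of _ "as @ bs"]) auto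
qed

lemma num_paths_gapE:
  assumes "num_paths E xs \<ge> 2"
  obtains as bs where "xs = as @ bs" "as \<noteq> []" "bs \<noteq> []" "(last as, hd bs) \<notin> E"
proof -
  have "\<exists>as bs. xs = as @ bs \<and> as \<noteq> [] \<and> bs \<noteq> [] \<and> (last as, hd bs) \<notin> E"
    using assms
  proof (induction E xs rule: num_paths.induct)
    case (3 E x y zs)
    show ?case
    proof (cases "(x, y) \<in> E")
      case True
      then obtain as bs where "y # zs = as @ bs" "as \<noteq> []" "bs \<noteq> []" "(last as, hd bs) \<notin> E"
        using 3 by auto
      then show ?thesis by (intro exI[of _ "x # as"] exI[of _ bs]) auto
    next
      case False
      then show ?thesis by (intro exI[of _ "[x]"] exI[of _ "y # zs"]) auto
    qed
  qed auto
  then show ?thesis using that by blast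
qed

text \<open>The new vertex bridges a gap and so merges two paths. Positivity of \<open>k\<close>
  covers the case of no gap, where one path is still needed.\<close>

lemma path_cover_insert:
  assumes "path_cover E W (Suc k)" "v \<notin> W" "k > 0"
    and "\<And>x. x \<in> W \<Longrightarrow> (x, v) \<in> E \<and> (v, x) \<in> E"
  shows "path_cover E (insert v W) k"
proof -
  obtain xs where xs: "distinct xs" "set xs = W" "num_paths E xs \<le> Suc k"
    using assms unfolding path_cover_def by blast
  show ?thesis
  proof (cases "num_paths E xs \<ge> 2")
    case True
    then obtain as bs where split: "xs = as @ bs" "as \<noteq> []" "bs \<noteq> []" "(last as, hd bs) \<notin> E"
      by (rule num_paths_gapE)
    have "last as \<in> W" "hd bs \<in> W" using xs split by auto
    then have "num_paths E (as @ v # bs) \<le> k"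
      using num_paths_append[of as bs E] num_paths_append[of as "v # bs" E] split assms(4) xs(3)
      by (auto simp: num_paths_Cons)
    then show ?thesis
      unfolding path_cover_def using xs split assms(2) by (intro exI[of _ "as @ v # bs"]) auto
  next
    case False
    have "num_paths E (v # xs) \<le> k"
      using False assms(3,4) xs(2) by (cases "xs = []") (auto simp: num_paths_Cons)
    then show ?thesis
      unfolding path_cover_def using xs assms(2) by (intro exI[of _ "v # xs"]) auto
  qed
qed

text \<open>Each vertex of \<open>U\<close> shifts the bound by one, so \<open>k\<close> is
  generalised in the induction. \<open>W\<close> may be empty, which is the case that serves
  complete graphs.\<close>

lemma path_cover_join:
  assumes "finite U" "U \<inter> W = {}" "k > 0"
    and "\<And>u x. u \<in> U \<Longrightarrow> x \<in> U \<union> W \<Longrightarrow> x \<noteq> u \<Longrightarrow> (x, u) \<in> E \<and> (u, x) \<in> E"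
  shows "path_cover E (U \<union> W) k \<longleftrightarrow> path_cover E W (k + card U)"
  using assms
proof (induction U arbitrary: k rule: finite_induct)
  case (insert u U)
  have "path_cover E (insert u (U \<union> W)) k \<longleftrightarrow> path_cover E (U \<union> W) (Suc k)"
    using path_cover_insert[of E "U \<union> W" k u] path_cover_delete[of E u "U \<union> W" k]
      insert.prems insert.hyps by blast
  moreover have "path_cover E (U \<union> W) (Suc k) \<longleftrightarrow> path_cover E W (Suc k + card U)"
    by (rule insert.IH) (use insert.prems in auto)
  ultimately show ?case using insert.hyps by simp
qed simp

section \<open>Hamiltonian cycles and joins\<close>

lemma successively_rotate:
  assumes "successively R (xs @ [hd xs])" "x \<in> set xs" "distinct xs"
  obtains zs where "distinct (x # zs)" "set (x # zs) = set xs" "successively R (x # zs @ [x])"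
proof -
  obtain as bs where split: "xs = as @ x # bs" using assms(2) by (metis split_list)
  \<comment> \<open>When both pieces are nonempty, the closing edge of the old cycle becomes the
    junction of \<open>bs\<close> and \<open>as\<close>, and the old junction before
    \<open>x\<close> closes the new one.\<close>
  have "successively R (x # (bs @ as) @ [x])"
    using assms(1) unfolding split
    by (cases as; cases bs)
      (auto simp: successively_append_iff successively_Cons hd_append split: if_splits)
  then show ?thesis using that[of "bs @ as"] assms(3) split by auto
qed

text \<open>Start the cycle at \<open>u\<close> and remove \<open>u\<close>: a path through all of
  \<open>W\<close> remains. Conversely \<open>u\<close> is adjacent to both ends of such a path and
  closes it.\<close>

lemma ham_insert_iff:
  assumes "u \<notin> W" "W \<noteq> {}" "\<And>x. x \<in> W \<Longrightarrow> (x, u) \<in> E \<and> (u, x) \<in> E"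
  shows "ham E (insert u W) \<longleftrightarrow> path_cover E W 1"
proof
  have *: "card (insert u W) \<noteq> 1"
    using assms(1,2) by (auto simp: card_1_singleton_iff)
  assume "ham E (insert u W)"
  then obtain xs where "distinct xs" "set xs = insert u W" 
      "successively (\<lambda>x y. (x, y) \<in> E) (xs @ [hd xs])"
    using * unfolding ham_def by blast
  then obtain zs where "distinct (u # zs)" "set (u # zs) = insert u W"
      "successively (\<lambda>x y. (x, y) \<in> E) (u # zs @ [u])"
    by (metis insertI1 successively_rotate)
  then have "distinct zs" "set zs = W" "successively (\<lambda>x y. (x, y) \<in> E) zs"
    using assms(1) by (auto simp: successively_Cons successively_append_iff)
  then show "path_cover E W 1" unfolding path_cover_def num_paths_le_1_iff by blast
next
  assume "path_cover E W 1"
  then obtain xs where "distinct xs" "set xs = W" "successively (\<lambda>x y. (x, y) \<in> E) xs"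
    unfolding path_cover_def num_paths_le_1_iff by blast
  moreover from this have "xs \<noteq> []" using assms(2) by auto
  moreover from calculation have "hd xs \<in> W" "last xs \<in> W"
    using hd_in_set last_in_set by blast+
  ultimately show "ham E (insert u W)"
    unfolding ham_def using assms
    by (intro disjI2 exI[of _ "u # xs"]) (auto simp: successively_Cons successively_append_iff)
qed

text \<open>One vertex of \<open>U\<close> closes a path to a cycle; each of the other
  \<open>card U - 1\<close> vertices allows \<open>W\<close> one further path.\<close>

lemma ham_join:
  assumes "finite U" "U \<noteq> {}" "U \<inter> W = {}" "W \<noteq> {}"
    and "\<And>u x. u \<in> U \<Longrightarrow> x \<in> U \<union> W \<Longrightarrow> x \<noteq> u \<Longrightarrow> (x, u) \<in> E \<and> (u, x) \<in> E"
  shows "ham E (U \<union> W) \<longleftrightarrow> path_cover E W (card U)"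
proof -
  obtain u where u: "u \<in> U" using assms(2) by blast
  let ?U = "U - {u}"
  have "ham E (insert u (?U \<union> W)) \<longleftrightarrow> path_cover E (?U \<union> W) 1"
    by (rule ham_insert_iff) (use u assms in auto)
  also have "\<dots> \<longleftrightarrow> path_cover E W (1 + card ?U)"
    by (rule path_cover_join) (use assms in auto)
  also have "1 + card ?U = card U" using card.remove[OF assms(1) u] by simp
  also have "insert u (?U \<union> W) = U \<union> W" using u by auto
  finally show ?thesis .
qed

lemma ham_imp_path_cover:
  assumes "ham E V"
  shows "path_cover E V 1"
proof -
  consider "card V = 1" | xs where "distinct xs" "set xs = V" "xs \<noteq> []"
      "successively (\<lambda>x y. (x, y) \<in> E) (xs @ [hd xs])"
    using assms unfolding ham_def by blast
  then show ?thesis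
  proof cases
    case 1
    then obtain v where "V = {v}" by (auto simp: card_1_singleton_iff)
    then show ?thesis unfolding path_cover_def by (intro exI[of _ "[v]"]) auto
  next
    case (2 xs)
    then show ?thesis
      unfolding path_cover_def num_paths_le_1_iff by (auto simp: successively_append_iff)
  qed
qed

text \<open>Cut the cycle at \<open>u\<close>: at most one of its two edges at \<open>u\<close> is the new one.\<close>

lemma path_cover_of_ham_insert_edge:
  assumes "ham (E \<union> {(u, v), (v, u)}) V" "card V \<ge> 3" "u \<in> V" "sym E"
  shows "path_cover E V 1"
proof -
  let ?E = "E \<union> {(u, v), (v, u)}"
  obtain xs where "distinct xs" "set xs = V" 
      "successively (\<lambda>x y. (x, y) \<in> ?E) (xs @ [hd xs])"
    using assms(1,2) unfolding ham_def by fastforce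
  then obtain zs where zs: "distinct (u # zs)" "set (u # zs) = V"
      "successively (\<lambda>x y. (x, y) \<in> ?E) (u # zs @ [u])"
    using assms(3) by (metis successively_rotate)
  \<comment> \<open>Three vertices guarantee that the two neighbours of \<open>u\<close> on the
    cycle differ. With two vertices the closed list could use the new edge in both
    directions.\<close>
  have "length zs \<ge> 2" using zs(1,2) assms(2) distinct_card[OF zs(1)] by simp
  then obtain x y ys where zs_eq: "zs = x # y # ys" by (metis Suc_le_length_iff numeral_2_eq_2)
  have ends: "hd zs \<noteq> last zs" using zs(1) last_in_set[of "y # ys"] by (auto simp: zs_eq)
  have "successively (\<lambda>x y. (x, y) \<in> ?E) zs"
    using zs(3) by (auto simp: successively_Cons successively_append_iff)
  then have zsE: "successively (\<lambda>x y. (x, y) \<in> E) zs"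
    by (rule successively_mono) (use zs(1) in auto)
  have "(u, hd zs) \<in> ?E" "(last zs, u) \<in> ?E"
    using zs(3) zs_eq by (auto simp: successively_Cons successively_append_iff)
  then consider "(u, hd zs) \<in> E" | "(last zs, u) \<in> E"
    using ends zs(1) by (auto simp: zs_eq)
  then obtain ws where "distinct ws" "set ws = V" "successively (\<lambda>x y. (x, y) \<in> E) ws"
  proof cases
    case 1
    then show ?thesis using that[of "u # zs"] zs zsE by (auto simp: successively_Cons)
  next
    case 2
    then show ?thesis using that[of "zs @ [u]"] zs zsE by (auto simp: successively_append_iff)
  qed
  then show ?thesis unfolding path_cover_def num_paths_le_1_iff by blast
qed

section \<open>Hamiltonicity and path covers\<close>

lemma simple_graph_iff:
  "simple_graph G \<longleftrightarrow> finite (pverts G) \<and> pverts G \<noteq> {} \<and> parcs G \<subseteq> pverts G \<times> pverts G \<and>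
     sym (parcs G) \<and> (\<forall>x. (x, x) \<notin> parcs G)"
proof
  assume "simple_graph G"
  then interpret pair_graph G by (simp add: simple_graph_def)
  show "finite (pverts G) \<and> pverts G \<noteq> {} \<and> parcs G \<subseteq> pverts G \<times> pverts G \<and>
     sym (parcs G) \<and> (\<forall>x. (x, x) \<notin> parcs G)"
    using \<open>simple_graph G\<close> pair_finite_verts pair_no_loops arcs_symmetric in_arcsD1 in_arcsD2
    by (fastforce simp: simple_graph_def sym_def)
next
  assume *: "finite (pverts G) \<and> pverts G \<noteq> {} \<and> parcs G \<subseteq> pverts G \<times> pverts G \<and>
     sym (parcs G) \<and> (\<forall>x. (x, x) \<notin> parcs G)"
  then have "finite (parcs G)" using finite_subset by blast
  with * have "pair_graph G"
    by unfold_locales (auto simp: symmetric_def)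
  then show "simple_graph G" using * by (simp add: simple_graph_def)
qed

lemma simple_graphD:
  assumes "simple_graph G"
  shows "finite (pverts G)" "pverts G \<noteq> {}" "parcs G \<subseteq> pverts G \<times> pverts G"
    "sym (parcs G)" "(x, x) \<notin> parcs G"
  using assms by (auto simp: simple_graph_iff)

text \<open>For positive \<open>n\<close> the cardinality alone forces finiteness, since infinite
  sets have cardinality 0.\<close>

lemma complete_digraph_iff:
  assumes "n > 0"
  shows "complete_digraph n (with_proj G) \<longleftrightarrow>
    card (pverts G) = n \<and> parcs G = {(u, v). u \<in> pverts G \<and> v \<in> pverts G \<and> u \<noteq> v}"
proof
  assume "complete_digraph n (with_proj G)"
  then show "card (pverts G) = n \<and> parcs G = {(u, v). u \<in> pverts G \<and> v \<in> pverts G \<and> u \<noteq> v}"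
    by (auto simp: complete_digraph_def)
next
  assume *: "card (pverts G) = n \<and> parcs G = {(u, v). u \<in> pverts G \<and> v \<in> pverts G \<and> u \<noteq> v}"
  then have "finite (pverts G)" "pverts G \<noteq> {}" using assms by (auto intro: card_ge_0_finite)
  then have "simple_graph G" using * by (auto simp: simple_graph_iff sym_def)
  then interpret pair_graph G by (simp add: simple_graph_def)
  show "complete_digraph n (with_proj G)"
    using * pair_graphD_graph by (auto simp: complete_digraph_def)
qed

lemma complete_graph_iff:
  "complete_graph G \<longleftrightarrow> finite (pverts G) \<and> pverts G \<noteq> {} \<and>
     parcs G = {(u, v). u \<in> pverts G \<and> v \<in> pverts G \<and> u \<noteq> v}"
  unfolding complete_graph_def by (auto simp: complete_digraph_iff card_gt_0_iff cong: conj_cong)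

text \<open>Passes from arc lists to vertex lists: the tails of the arcs, followed by the end
  vertex, form the walk.\<close>

lemma pcas_closedD:
  assumes "pcas u p w" "set p \<subseteq> E"
  shows "pawalk_verts u p = map fst p @ [w]" "successively (\<lambda>x y. (x, y) \<in> E) (map fst p @ [w])"
    "hd (map fst p @ [w]) = u"
  using assms
proof (induction p arbitrary: u)
  case (Cons e p)
  {
    case 1
    then show ?case using Cons by simp
  next
    case 2
    then show ?case using Cons.IH(2,3)[of "snd e"] by (auto simp: successively_Cons)
  next
    case 3
    then show ?case by simp
  }
qed auto

text \<open>The inverse translation: pairing each vertex with its successor recovers the
  arcs.\<close>

lemma pcas_zipI:
  assumes "successively (\<lambda>x y. (x, y) \<in> E) (x # xs @ [w])"
  shows "pcas x (zip (x # xs) (xs @ [w])) w \<and> set (zip (x # xs) (xs @ [w])) \<subseteq> E"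
  using assms by (induction xs arbitrary: x) auto

lemma pawalk_verts_zip: "pawalk_verts x (zip (x # xs) (xs @ [w])) = x # xs @ [w]"
  by (induction xs arbitrary: x) auto

lemma cycle_with_proj_iff:
  "pre_digraph.cycle (with_proj G) p \<longleftrightarrow>
     (\<exists>u. u \<in> pverts G \<and> set p \<subseteq> parcs G \<and> pcas u p u \<and> distinct (tl (pawalk_verts u p)) \<and> p \<noteq> [])"
  by (simp add: pre_digraph.cycle_def pre_digraph.awalk_def cas_with_proj_eq
      awalk_verts_with_proj_eq)

text \<open>The closed list on two adjacent vertices stands for \<open>K_2\<close>; from three
  vertices on, vertex lists and directed cycles correspond by taking tails of arcs and by
  zipping.\<close>

lemma hamiltonian_iff_ham:
  assumes "simple_graph G"
  shows "hamiltonian G \<longleftrightarrow> ham (parcs G) (pverts G)"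
proof
  note G = simple_graphD[OF assms]
  assume "hamiltonian G"
  then consider "card (pverts G) = 1"
    | "card (pverts G) = 2" "parcs G = {(u, v). u \<in> pverts G \<and> v \<in> pverts G \<and> u \<noteq> v}"
    | p where "pre_digraph.cycle (with_proj G) p" "fst ` set p = pverts G"
    unfolding hamiltonian_def using complete_digraph_iff[of 1 G] complete_digraph_iff[of 2 G] by auto
  then show "ham (parcs G) (pverts G)"
  proof cases
    case 1
    then show ?thesis by (simp add: ham_def)
  next
    case 2
    then obtain a b where "pverts G = {a, b}" "a \<noteq> b" by (meson card_2_iff)
    then show ?thesis
      unfolding ham_def using 2(2) by (intro disjI2 exI[of _ "[a, b]"]) auto
  next
    case (3 p)
    then obtain u where u: "set p \<subseteq> parcs G" "pcas u p u" "distinct (tl (pawalk_verts u p))" "p \<noteq> []"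
      unfolding cycle_with_proj_iff by blast
    have "hd (map fst p) = u" using pcas_closedD(3)[OF u(2,1)] u(4) by (cases p) auto
    moreover have "distinct (map fst p)"
      using u(3,4) \<open>hd (map fst p) = u\<close> pcas_closedD(1)[OF u(2,1)] by (cases p) auto
    ultimately show ?thesis
      unfolding ham_def using 3(2) u(4) pcas_closedD(2)[OF u(2,1)]
      by (intro disjI2 exI[of _ "map fst p"]) auto
  qed
next
  note G = simple_graphD[OF assms]
  assume "ham (parcs G) (pverts G)"
  then consider "card (pverts G) = 1"
    | xs where "distinct xs" "set xs = pverts G" "xs \<noteq> []"
      "successively (\<lambda>x y. (x, y) \<in> parcs G) (xs @ [hd xs])"
    unfolding ham_def by blast
  then show "hamiltonian G"
  proof cases
    case 1
    then obtain v where "pverts G = {v}" by (auto simp: card_1_singleton_iff)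
    then have "complete_digraph 1 (with_proj G)"
      using G(3,5) 1 by (subst complete_digraph_iff) auto
    then show ?thesis by (simp add: hamiltonian_def)
  next
    case (2 xs)
    then obtain x ys where xs: "xs = x # ys" by (cases xs) auto
    show ?thesis
    proof (cases "length xs \<ge> 3")
      case True
      define p where "p = zip (x # ys) (ys @ [x])"
      have len: "length p = length xs" by (simp add: p_def xs)
      have "map fst p = xs" by (simp add: p_def xs)
      then have "fst ` set p = pverts G" using 2(2) by (metis list.set_map)
      moreover have "pcas x p x \<and> set p \<subseteq> parcs G"
        unfolding p_def using 2(4) by (intro pcas_zipI) (simp add: xs)
      moreover have "distinct (tl (pawalk_verts x p))"
        using 2(1) unfolding p_def pawalk_verts_zip by (simp add: xs)
      ultimately have "pre_digraph.cycle (with_proj G) p"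
        unfolding cycle_with_proj_iff using 2(2) len xs by (intro exI[of _ x]) auto
      then show ?thesis
        using True len \<open>fst ` set p = pverts G\<close> by (auto simp: hamiltonian_def)
    next
      case False
      \<comment> \<open>A single vertex would be its own successor, which is a loop; so a list of
        length below three is an edge.\<close>
      have "ys \<noteq> []" using 2(4) G(5) by (auto simp: xs)
      then obtain y where ys: "ys = [y]" using False by (cases ys; cases "tl ys") (auto simp: xs)
      then have "pverts G = {x, y}" "x \<noteq> y" "(x, y) \<in> parcs G" "(y, x) \<in> parcs G"
        using 2 by (auto simp: xs)
      then have "complete_digraph 2 (with_proj G)"
        using G(3,5) by (subst complete_digraph_iff) auto
      then show ?thesis by (simp add: hamiltonian_def)
    qed
  qed
qed

section \<open>Joins with complete graphs and the value of \<open>mu\<close>\<close>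

lemma pverts_join_K [simp]:
  "pverts (graph_join (K_graph l) G) = Inl ` {..<l} \<union> Inr ` pverts G"
  by (auto simp: graph_join_def K_graph_def)

lemma parcs_join_K [simp]:
  "(Inl i, Inl j) \<in> parcs (graph_join (K_graph l) G) \<longleftrightarrow> i < l \<and> j < l \<and> i \<noteq> j"
  "(Inr x, Inr y) \<in> parcs (graph_join (K_graph l) G) \<longleftrightarrow> (x, y) \<in> parcs G"
  "(Inl i, Inr y) \<in> parcs (graph_join (K_graph l) G) \<longleftrightarrow> i < l \<and> y \<in> pverts G"
  "(Inr x, Inl j) \<in> parcs (graph_join (K_graph l) G) \<longleftrightarrow> j < l \<and> x \<in> pverts G"
  by (force simp: graph_join_def K_graph_def)+

lemma simple_graph_join_K:
  assumes "simple_graph G"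
  shows "simple_graph (graph_join (K_graph l) G)"
proof -
  note G = simple_graphD[OF assms]
  have "(a, b) \<in> parcs (graph_join (K_graph l) G) \<Longrightarrow>
      a \<in> pverts (graph_join (K_graph l) G) \<and> b \<in> pverts (graph_join (K_graph l) G) \<and>
      (b, a) \<in> parcs (graph_join (K_graph l) G) \<and> a \<noteq> b" for a b
    using G(3-5) by (cases a; cases b) (auto dest: symD)
  then show ?thesis unfolding simple_graph_iff using G(1,2) by (auto intro!: symI)
qed

text \<open>\<open>K_l\<close> and the universal vertices in \<open>U\<close> act together as the
  joined part. An empty \<open>U\<close> relates \<open>mu\<close> to the path number of
  \<open>G\<close>; a nonempty \<open>U\<close> makes the criterion valid for \<open>l = 0\<close>
  too.\<close>

lemma hamiltonian_join_K_iff: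
  assumes "simple_graph G" "U \<subseteq> pverts G" "pverts G - U \<noteq> {}" "l + card U > 0"
    and "\<And>u x. u \<in> U \<Longrightarrow> x \<in> pverts G \<Longrightarrow> x \<noteq> u \<Longrightarrow> (u, x) \<in> parcs G"
  shows "hamiltonian (graph_join (K_graph l) G) \<longleftrightarrow>
    path_number (parcs G) (pverts G - U) \<le> l + card U"
proof -
  note G = simple_graphD[OF assms(1)]
  have finU: "finite U" using assms(2) G(1) finite_subset by blast
  let ?U = "Inl ` {..<l} \<union> Inr ` U" and ?W = "Inr ` (pverts G - U)"
    and ?E = "parcs (graph_join (K_graph l) G)"
  have "pverts (graph_join (K_graph l) G) = ?U \<union> ?W" using assms(2) by auto
  then have "hamiltonian (graph_join (K_graph l) G) \<longleftrightarrow> ham ?E (?U \<union> ?W)"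
    using hamiltonian_iff_ham[OF simple_graph_join_K[OF assms(1)]] by simp
  also have "\<dots> \<longleftrightarrow> path_cover ?E ?W (card ?U)"
  proof (rule ham_join)
    show "finite ?U" using finU by simp
    show "?U \<noteq> {}" using assms(4) finU by (cases "l = 0") auto
    show "?U \<inter> ?W = {}" "?W \<noteq> {}" using assms(3) by auto
    show "(x, u) \<in> ?E \<and> (u, x) \<in> ?E" if "u \<in> ?U" "x \<in> ?U \<union> ?W" "x \<noteq> u" for u x
      using that assms(2,5) symD[OF G(4)] by (cases u; cases x) auto
  qed
  also have "\<dots> \<longleftrightarrow> path_cover (parcs G) (pverts G - U) (card ?U)"
    by (rule path_cover_image) auto
  also have "card ?U = l + card U"
    using finU by (subst card_Un_disjoint) (auto simp: card_image)
  finally show ?thesis using G(1) by (simp add: path_cover_iff)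
qed

lemma hamiltonian_join_K_0:
  assumes "simple_graph G"
  shows "hamiltonian (graph_join (K_graph 0) G) \<longleftrightarrow> hamiltonian G"
proof -
  have "ham (parcs (graph_join (K_graph 0) G)) (Inr ` pverts G) \<longleftrightarrow> ham (parcs G) (pverts G)"
    by (rule ham_image) auto
  then show ?thesis
    using hamiltonian_iff_ham[OF assms] hamiltonian_iff_ham[OF simple_graph_join_K[OF assms]]
    by simp
qed

text \<open>For \<open>l > 0\<close> Hamiltonicity of the join is governed by the path number alone;
  only \<open>l = 0\<close> asks for a cycle in \<open>G\<close> itself.\<close>

lemma mu_eq:
  assumes "simple_graph G"
  shows "mu G = (if hamiltonian G then 0 else path_number (parcs G) (pverts G))"
proof -
  note G = simple_graphD[OF assms]
  have iff: "hamiltonian (graph_join (K_graph l) G) \<longleftrightarrow> path_number (parcs G) (pverts G) \<le> l"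
    if "l > 0" for l
    using hamiltonian_join_K_iff[OF assms, of "{}" l] that G(2) by simp
  show ?thesis
  proof (cases "hamiltonian G")
    case True
    then show ?thesis
      unfolding mu_def using hamiltonian_join_K_0[OF assms] by (auto intro: Least_eq_0)
  next
    case False
    have "mu G = path_number (parcs G) (pverts G)"
      unfolding mu_def
    proof (rule Least_equality)
      show "hamiltonian (graph_join (K_graph (path_number (parcs G) (pverts G))) G)"
        using iff path_number_pos[OF G(1,2)] by blast
      show "path_number (parcs G) (pverts G) \<le> l" if "hamiltonian (graph_join (K_graph l) G)" for l
        using that iff[of l] hamiltonian_join_K_0[OF assms] False by (cases "l = 0") auto
    qed
    then show ?thesis using False by simp
  qed
qed

text \<open>A Hamiltonian graph has \<open>mu\<close> 0 but path number 1; the indicator makes up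
  for this.\<close>

lemma mu_add_i_H:
  assumes "simple_graph G"
  shows "mu G + i_H G = path_number (parcs G) (pverts G)"
proof -
  note G = simple_graphD[OF assms]
  have "path_number (parcs G) (pverts G) = 1" if "hamiltonian G"
    using that hamiltonian_iff_ham[OF assms] ham_imp_path_cover[of "parcs G" "pverts G"]
      path_cover_iff[OF G(1), of "parcs G" 1] path_number_pos[OF G(1,2), of "parcs G"] by simp
  then show ?thesis using mu_eq[OF assms] by (simp add: i_H_def)
qed

text \<open>With \<open>U\<close> nonempty the criterion holds from \<open>l = 0\<close> on, so a
  Hamiltonian \<open>G\<close> is no exception. The subtraction is truncated, matching the minimum
  0.\<close>

lemma mu_eq_delete_universal:
  assumes "simple_graph G" "U \<subseteq> pverts G" "pverts G - U \<noteq> {}" "U \<noteq> {}"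
    and "\<And>u x. u \<in> U \<Longrightarrow> x \<in> pverts G \<Longrightarrow> x \<noteq> u \<Longrightarrow> (u, x) \<in> parcs G"
  shows "mu G = path_number (parcs G) (pverts G - U) - card U"
proof -
  have "card U > 0"
    using assms(2,4) simple_graphD(1)[OF assms(1)] finite_subset card_gt_0_iff by blast
  then have "hamiltonian (graph_join (K_graph l) G) \<longleftrightarrow>
      path_number (parcs G) (pverts G - U) \<le> l + card U" for l
    using hamiltonian_join_K_iff[OF assms(1-3) _ assms(5)] by simp
  then show ?thesis unfolding mu_def by (intro Least_equality) auto
qed

section \<open>Universal vertices, components and connectedness in terms of arcs\<close>

lemma mem_universal_verts_iff:
  assumes "simple_graph G"
  shows "v \<in> universal_verts G \<longleftrightarrow> v \<in> pverts G \<and> (\<forall>x\<in>pverts G. x \<noteq> v \<longrightarrow> (v, x) \<in> parcs G)"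
proof (cases "v \<in> pverts G")
  case True
  note G = simple_graphD[OF assms]
  let ?N = "{x. (v, x) \<in> parcs G}"
  have "out_arcs (with_proj G) v = Pair v ` ?N" by (auto simp: out_arcs_def)
  then have "out_degree (with_proj G) v = card ?N"
    by (simp add: out_degree_def card_image inj_on_def)
  moreover have sub: "?N \<subseteq> pverts G - {v}" using G(3,5) by auto
  moreover have "card (pverts G - {v}) = card (pverts G) - 1" using True G(1) by simp
  ultimately have "v \<in> universal_verts G \<longleftrightarrow> card ?N = card (pverts G - {v})"
    using True by (simp add: universal_verts_def)
  also have "\<dots> \<longleftrightarrow> ?N = pverts G - {v}"
    using card_subset_eq[OF finite_Diff[OF G(1)] sub] by (metis (no_types))
  also have "\<dots> \<longleftrightarrow> (\<forall>x\<in>pverts G. x \<noteq> v \<longrightarrow> (v, x) \<in> parcs G)" using sub by blast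
  finally show ?thesis using True by simp
qed (simp add: universal_verts_def)

definition induced :: "'a pair_pre_digraph \<Rightarrow> 'a set \<Rightarrow> 'a pair_pre_digraph" where
  "induced G S = \<lparr> pverts = S, parcs = parcs G \<inter> S \<times> S \<rparr>"

lemma induced_simps [simp]:
  "pverts (induced G S) = S" "parcs (induced G S) = parcs G \<inter> S \<times> S"
  by (simp_all add: induced_def)

text \<open>By symmetry, reachability is an equivalence relation on the vertices, and its classes
  span the strongly connected components.\<close>

lemma components_eq:
  assumes "simple_graph G"
  shows "components G = (\<lambda>v. induced G {w. (v, w) \<in> (parcs G)\<^sup>*}) ` pverts G"
proof -
  interpret pair_graph G using assms by (simp add: simple_graph_def)
  have reach: "(v, w) \<in> (parcs G)\<^sup>* \<longleftrightarrow> v \<rightarrow>\<^sup>*\<^bsub>with_proj G\<^esub> w" if "v \<in> pverts G" for v w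
    using that reachable_conv'[of v w] by simp
  have "scc_of v = {w. (v, w) \<in> (parcs G)\<^sup>*}" if "v \<in> pverts G" for v
    using reach[OF that] symmetric_reachable' by (auto simp: scc_of_def)
  moreover have "with_proj H = with_proj G \<restriction> S \<longleftrightarrow> H = induced G S" for H S
    by (cases H) (auto simp: induce_subgraph_def with_proj_def induced_def)
  ultimately show ?thesis
    by (auto simp: components_def sccs_conv_sccs_verts sccs_verts_conv_scc_of)
qed

lemma connected_iff:
  assumes "simple_graph G"
  shows "Digraph_Component.connected (with_proj G) \<longleftrightarrow>
    (\<forall>u\<in>pverts G. \<forall>v\<in>pverts G. (u, v) \<in> (parcs G)\<^sup>*)"
proof -
  interpret pair_graph G using assms by (simp add: simple_graph_def)
  have "mk_symmetric (with_proj G) = G"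
    using arcs_symmetric by (cases G) (auto simp: mk_symmetric_def)
  then show ?thesis
    using assms reachable_conv
    by (auto simp: Digraph_Component.connected_def strongly_connected_def simple_graph_def)
qed

section \<open>Components\<close>

lemma del_verts_eq_induced: "del_verts G S = induced G (pverts G - S)"
  by (simp add: del_verts_def induced_def)

lemma simple_graph_induced:
  "simple_graph G \<Longrightarrow> S \<subseteq> pverts G \<Longrightarrow> S \<noteq> {} \<Longrightarrow> simple_graph (induced G S)"
  unfolding simple_graph_iff sym_def by (auto dest: finite_subset)

text \<open>A walk that starts in a set closed under edges never leaves it. Thus vertices of a
  component are linked inside the component.\<close>

lemma rtrancl_Int_closed:
  assumes "(x, y) \<in> E\<^sup>*" "x \<in> S" "\<And>a b. a \<in> S \<Longrightarrow> (a, b) \<in> E \<Longrightarrow> b \<in> S"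
  shows "(x, y) \<in> (E \<inter> S \<times> S)\<^sup>* \<and> y \<in> S"
  using assms(1)
proof induction
  case (step y z)
  then show ?case using assms(3)[of y z] by (auto intro: rtrancl_into_rtrancl)
qed (use assms in auto)

lemma componentsD:
  assumes "simple_graph G" "H \<in> components G"
  shows "H = induced G (pverts H)" "pverts H \<subseteq> pverts G" "pverts H \<noteq> {}"
    "x \<in> pverts H \<Longrightarrow> (x, y) \<in> parcs G \<Longrightarrow> y \<in> pverts H"
    "x \<in> pverts H \<Longrightarrow> y \<in> pverts H \<Longrightarrow> (x, y) \<in> (parcs H)\<^sup>*"
    "x \<in> pverts H \<Longrightarrow> pverts H = {w. (x, w) \<in> (parcs G)\<^sup>*}"
proof -
  note G = simple_graphD[OF assms(1)]
  obtain v where v: "v \<in> pverts G" "H = induced G {w. (v, w) \<in> (parcs G)\<^sup>*}"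
    using assms by (auto simp: components_eq)
  have verts: "pverts H = {w. (v, w) \<in> (parcs G)\<^sup>*}" using v by simp
  show eq: "H = induced G (pverts H)" using v by simp
  show "pverts H \<noteq> {}" using verts by auto
  have "w \<in> pverts G" if "(v, w) \<in> (parcs G)\<^sup>*" for w
    using that v(1) G(3) by (auto elim: rtranclE)
  then show "pverts H \<subseteq> pverts G" using verts by auto
  show closed: "y \<in> pverts H" if "x \<in> pverts H" "(x, y) \<in> parcs G" for x y
    using that verts by (auto intro: rtrancl_into_rtrancl)
  show cls: "pverts H = {w. (x, w) \<in> (parcs G)\<^sup>*}" if "x \<in> pverts H" for x
    using that verts symD[OF sym_rtrancl[OF G(4)]] by (auto intro: rtrancl_trans)
  show "(x, y) \<in> (parcs H)\<^sup>*" if "x \<in> pverts H" "y \<in> pverts H" for x y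
  proof -
    have "(x, y) \<in> (parcs G)\<^sup>*" using cls[OF that(1)] that(2) by auto
    then have "(x, y) \<in> (parcs G \<inter> pverts H \<times> pverts H)\<^sup>*"
      using rtrancl_Int_closed[OF _ that(1)] closed by blast
    then show ?thesis using arg_cong[OF eq, of parcs] by simp
  qed
qed

lemma components_eq_if_common_vertex:
  assumes "simple_graph G" "H \<in> components G" "H' \<in> components G" "x \<in> pverts H" "x \<in> pverts H'"
  shows "H = H'"
  using componentsD(1,6)[OF assms(1)] assms by metis

text \<open>Such a set is the reachability class of each of its vertices. This recognises the parts
  of an arbitrary join decomposition as components.\<close>

lemma in_componentsI:
  assumes "simple_graph G" "S \<subseteq> pverts G" "S \<noteq> {}"
    and "\<And>x y. x \<in> S \<Longrightarrow> (x, y) \<in> parcs G \<Longrightarrow> y \<in> S"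
    and "\<And>x y. x \<in> S \<Longrightarrow> y \<in> S \<Longrightarrow> (x, y) \<in> (parcs G)\<^sup>*"
  shows "induced G S \<in> components G"
proof -
  obtain v where v: "v \<in> S" using assms(3) by blast
  have "S = {w. (v, w) \<in> (parcs G)\<^sup>*}"
    using assms(5)[OF v] rtrancl_Int_closed[OF _ v, of _ "parcs G"] assms(4) by blast
  then show ?thesis using v assms(2) by (auto simp: components_eq[OF assms(1)])
qed

lemma Union_components:
  assumes "simple_graph G"
  shows "(\<Union>H\<in>components G. pverts H) = pverts G"
proof
  show "(\<Union>H\<in>components G. pverts H) \<subseteq> pverts G" using componentsD(2)[OF assms] by blast
  show "pverts G \<subseteq> (\<Union>H\<in>components G. pverts H)" by (auto simp: components_eq[OF assms])
qed

lemma simple_graph_component: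
  assumes "simple_graph G" "H \<in> components G"
  shows "simple_graph H"
  using simple_graph_induced[OF assms(1)] componentsD(1-3)[OF assms] by metis

section \<open>Added edges, complete graphs and criticality\<close>

lemma simple_graph_add_edge:
  "simple_graph G \<Longrightarrow> u \<in> pverts G \<Longrightarrow> v \<in> pverts G \<Longrightarrow> u \<noteq> v \<Longrightarrow> simple_graph (add_edge G u v)"
  by (auto simp: simple_graph_iff add_edge_def sym_def)

lemma add_edge_simps [simp]:
  "pverts (add_edge G u v) = pverts G" "parcs (add_edge G u v) = parcs G \<union> {(u, v), (v, u)}"
  by (simp_all add: add_edge_def)

lemma simple_graph_complete: "complete_graph G \<Longrightarrow> simple_graph G"
  by (auto simp: complete_graph_iff simple_graph_iff sym_def)

lemma hamiltonian_complete:
  assumes "complete_graph G"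
  shows "hamiltonian G"
proof -
  note G = assms[unfolded complete_graph_iff]
  obtain u where u: "u \<in> pverts G" using G by blast
  let ?W = "pverts G - {u}"
  have "ham (parcs G) (pverts G)"
  proof (cases "?W = {}")
    case True
    then have "pverts G = {u}" using u by blast
    then show ?thesis by (simp add: ham_def)
  next
    case False
    \<comment> \<open>The vertices other than \<open>u\<close> are joined to the empty set, which
      any bound covers, so they can be covered by a single path.\<close>
    have "path_cover (parcs G) {} (1 + card ?W)" by (simp add: path_cover_def)
    then have "path_cover (parcs G) (?W \<union> {}) 1"
      using G by (subst path_cover_join) auto
    then have "ham (parcs G) (insert u ?W)"
      using False G u by (subst ham_insert_iff) auto
    then show ?thesis using u by (simp add: insert_absorb)
  qed
  then show ?thesis using simple_graph_complete[OF assms] hamiltonian_iff_ham by blast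
qed

lemma mu_complete: "complete_graph G \<Longrightarrow> mu G = 0"
  by (simp add: mu_eq[OF simple_graph_complete] hamiltonian_complete)

lemma not_complete_if_M_class:
  assumes "G \<in> M_class t" "t > 0"
  shows "\<not> complete_graph G"
  using assms mu_complete[of G] by (auto simp: M_class_def)

lemma exists_not_universal:
  assumes "simple_graph G" "\<not> complete_graph G"
  shows "pverts G - universal_verts G \<noteq> {}"
proof -
  note G = simple_graphD[OF assms(1)]
  have "complete_graph G" if "pverts G \<subseteq> universal_verts G"
    using that G mem_universal_verts_iff[OF assms(1)]
    by (auto simp: complete_graph_iff)
  then show ?thesis using assms(2) by blast
qed

text \<open>Translates criticality of \<open>G\<close> into path numbers on \<open>W\<close>. As
  \<open>t > 0\<close>, the truncated difference giving \<open>mu\<close> can be solved for the path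
  number. Without universal vertices a new edge may instead create a Hamiltonian cycle, whence the
  second alternative.\<close>

lemma M_class_delete_universal:
  assumes "G \<in> M_class t" "t > 0"
  defines "W \<equiv> pverts G - universal_verts G"
  shows "path_number (parcs G) W = t + card (universal_verts G)"
    and "u \<in> W \<Longrightarrow> v \<in> W \<Longrightarrow> u \<noteq> v \<Longrightarrow> (u, v) \<notin> parcs G \<Longrightarrow>
      path_number (parcs G \<union> {(u, v), (v, u)}) W < t + card (universal_verts G) \<or>
      universal_verts G = {} \<and> ham (parcs G \<union> {(u, v), (v, u)}) W"
proof -
  have simple: "simple_graph G" and mu: "mu G = t"
    and crit: "\<And>u v. u \<in> pverts G \<Longrightarrow> v \<in> pverts G \<Longrightarrow> u \<noteq> v \<Longrightarrow> (u, v) \<notin> parcs G \<Longrightarrow>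
      mu (add_edge G u v) < t"
    using assms(1) by (auto simp: M_class_def)
  let ?U = "universal_verts G"
  note univ = mem_universal_verts_iff[OF simple]
  have W: "W \<noteq> {}"
    unfolding W_def using exists_not_universal[OF simple] not_complete_if_M_class assms(1,2) by blast
  have sub: "?U \<subseteq> pverts G" using univ by blast
  show pn: "path_number (parcs G) W = t + card ?U"
  proof (cases "?U = {}")
    case True
    then show ?thesis
      using mu_eq[OF simple] mu assms(2) by (auto simp: W_def split: if_splits)
  next
    case False
    then show ?thesis
      using mu_eq_delete_universal[OF simple sub W[unfolded W_def] False] univ mu assms(2)
      by (auto simp: W_def)
  qed
  assume uv: "u \<in> W" "v \<in> W" "u \<noteq> v" "(u, v) \<notin> parcs G"
  then have simple': "simple_graph (add_edge G u v)"
    using simple_graph_add_edge[OF simple] by (auto simp: W_def)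
  have mu': "mu (add_edge G u v) < t" using crit uv by (auto simp: W_def)
  show "path_number (parcs G \<union> {(u, v), (v, u)}) W < t + card ?U \<or>
      ?U = {} \<and> ham (parcs G \<union> {(u, v), (v, u)}) W"
  proof (cases "?U = {}")
    case True
    then show ?thesis
      using mu_eq[OF simple'] hamiltonian_iff_ham[OF simple'] mu'
      by (auto simp: W_def split: if_splits)
  next
    case False
    then show ?thesis
      using mu_eq_delete_universal[OF simple', of ?U] sub W univ mu'
      by (auto simp: W_def)
  qed
qed

text \<open>Additivity localises a new edge inside \<open>C\<close>: the rest of \<open>D\<close>
  keeps its path number, so that of \<open>C\<close> must drop.\<close>

lemma component_in_N_class:
  assumes simple: "simple_graph D" and no_univ: "universal_verts D = {}"
    and comp: "C \<in> components D" and incomplete: "\<not> complete_graph C"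
    and crit: "\<And>u v. u \<in> pverts D \<Longrightarrow> v \<in> pverts D \<Longrightarrow> u \<noteq> v \<Longrightarrow> (u, v) \<notin> parcs D \<Longrightarrow>
      path_number (parcs D \<union> {(u, v), (v, u)}) (pverts D) < path_number (parcs D) (pverts D)"
  shows "mu C > 0" "C \<in> N_class (mu C)"
proof -
  note D = simple_graphD[OF simple]
  let ?E = "parcs D" and ?A = "pverts C" and ?B = "pverts D - pverts C"
  note c = componentsD[OF simple comp]
  have simpleC: "simple_graph C" by (rule simple_graph_component[OF simple comp])
  note C = simple_graphD[OF simpleC]
  have parcsC: "parcs C = ?E \<inter> ?A \<times> ?A" using arg_cong[OF c(1), of parcs] by simp
  have V: "pverts D = ?A \<union> ?B" using c(2) by blast
  have cross: "(a, b) \<notin> ?E \<and> (b, a) \<notin> ?E" if "a \<in> ?A" "b \<in> ?B" for a b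
    using that c(4) symD[OF D(4)] by blast
  have sum: "path_number ?E (pverts D) = path_number ?E ?A + path_number ?E ?B"
    by (subst V, rule path_number_Un) (use C(1) D(1) cross in auto)
  have pnC: "path_number (parcs C) ?A = path_number ?E ?A"
    by (rule path_number_cong) (simp add: parcsC)
  have critC: "path_number (parcs C \<union> {(u, v), (v, u)}) ?A < path_number ?E ?A"
    if uv: "u \<in> ?A" "v \<in> ?A" "u \<noteq> v" "(u, v) \<notin> parcs C" for u v
  proof -
    let ?F = "?E \<union> {(u, v), (v, u)}"
    have "path_number ?F (?A \<union> ?B) = path_number ?F ?A + path_number ?F ?B"
      by (rule path_number_Un) (use C(1) D(1) cross uv in auto)
    moreover have "path_number ?F ?B = path_number ?E ?B"
      by (rule path_number_cong) (use uv in auto)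
    moreover have "path_number ?F ?A = path_number (parcs C \<union> {(u, v), (v, u)}) ?A"
      by (rule path_number_cong) (simp add: parcsC)
    moreover have "path_number ?F (pverts D) < path_number ?E (pverts D)"
      by (rule crit) (use uv c(2) parcsC in auto)
    ultimately show ?thesis using sum V by simp
  qed
  obtain u v where uv: "u \<in> ?A" "v \<in> ?A" "u \<noteq> v" "(u, v) \<notin> parcs C"
    using incomplete C unfolding complete_graph_iff by auto
  \<comment> \<open>After adding a missing edge the path number has dropped and is still positive,
    so it was at least 2. In particular \<open>C\<close> is not Hamiltonian.\<close>
  have ge2: "path_number ?E ?A \<ge> 2"
    using critC[OF uv] path_number_pos[OF C(1,2), of "parcs C \<union> {(u, v), (v, u)}"] by simp
  show mu_pos: "mu C > 0"
    using mu_add_i_H[OF simpleC] ge2 pnC by (auto simp: i_H_def split: if_splits)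
  then have mu: "mu C = path_number ?E ?A"
    using mu_eq[OF simpleC] pnC by (auto split: if_splits)
  have "mu (add_edge C u v) < mu C"
    if "u \<in> ?A" "v \<in> ?A" "u \<noteq> v" "(u, v) \<notin> parcs C" for u v
    using critC[OF that] mu mu_eq[OF simple_graph_add_edge[OF simpleC that(1-3)]] mu_pos by auto
  then have "C \<in> M_class (mu C)" using simpleC by (auto simp: M_class_def)
  moreover have "Digraph_Component.connected (with_proj C)"
    using connected_iff[OF simpleC] c(5) by blast
  moreover have "v \<notin> universal_verts C" for v
  proof
    \<comment> \<open>If \<open>v\<close> is universal in \<open>C\<close>, then deleting \<open>v\<close> raises the path number of \<open>C\<close>. An edge from \<open>v\<close>
      to another component disappears with \<open>v\<close> and hence cannot lower the path number of \<open>D\<close>.\<close>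
    assume "v \<in> universal_verts C"
    then have v: "v \<in> ?A" "\<And>x. x \<in> ?A \<Longrightarrow> x \<noteq> v \<Longrightarrow> (v, x) \<in> ?E"
      using mem_universal_verts_iff[OF simpleC] parcsC by auto
    have "?B \<noteq> {}"
    proof
      assume "?B = {}"
      then have "v \<in> universal_verts D"
        using v c(2) mem_universal_verts_iff[OF simple] by auto
      then show False using no_univ by simp
    qed
    then obtain u where u: "u \<in> ?B" by blast
    let ?F = "?E \<union> {(v, u), (u, v)}" and ?A' = "?A - {v}"
    have "path_number ?F (pverts D) < path_number ?E (pverts D)"
      by (rule crit) (use u v(1) c(2) cross in auto)
    moreover have "path_number ?F (?A' \<union> ?B) \<le> Suc (path_number ?F (pverts D))"
    proof -
      have "insert v (?A' \<union> ?B) = pverts D" using v(1) c(2) by blast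
      then have "path_cover ?F (insert v (?A' \<union> ?B)) (path_number ?F (pverts D))"
        using D(1) by (simp add: path_cover_iff)
      then have "path_cover ?F (?A' \<union> ?B) (Suc (path_number ?F (pverts D)))"
        by (rule path_cover_delete) (use v(1) in auto)
      then show ?thesis using C(1) D(1) by (simp add: path_cover_iff)
    qed
    moreover have "path_number ?F (?A' \<union> ?B) = path_number ?E (?A' \<union> ?B)"
      by (rule path_number_cong) (use v(1) in auto)
    moreover have "path_number ?E (?A' \<union> ?B) = path_number ?E ?A' + path_number ?E ?B"
      by (rule path_number_Un) (use C(1) D(1) cross in auto)
    moreover have "path_number ?E ?A < path_number ?E ?A'"
    proof -
      \<comment> \<open>The maximum supplies the positive bound required by
        \<open>path_cover_insert\<close>; the bound 1 would contradict \<open>ge2\<close>, so the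
        other value applies.\<close>
      let ?k = "max 1 (path_number ?E ?A' - 1)"
      have "path_cover ?E ?A' (Suc ?k)" using C(1) by (simp add: path_cover_iff)
      then have "path_cover ?E (insert v ?A') ?k"
        by (rule path_cover_insert) (use v(2) symD[OF D(4)] in auto)
      then have "path_number ?E ?A \<le> ?k"
        using v(1) C(1) by (simp add: insert_absorb path_cover_iff)
      then show ?thesis using ge2 by (simp add: max_def split: if_splits)
    qed
    \<comment> \<open>Deleting \<open>v\<close> costs at most one path and the new edge saved at
      least one, so \<open>?A' \<union> ?B\<close> needs no more paths than \<open>D\<close>; by the
      last two facts it needs more.\<close>
    ultimately show False using sum by simp
  qed
  ultimately show "C \<in> N_class (mu C)" by (auto simp: N_class_def)
qed

section \<open>Isomorphisms and joins of disjoint unions\<close>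

lemma graph_iso_iff:
  assumes "parcs H \<subseteq> pverts H \<times> pverts H" "parcs G \<subseteq> pverts G \<times> pverts G"
  shows "graph_iso f H G \<longleftrightarrow> inj_on f (pverts H) \<and> f ` pverts H = pverts G \<and>
    (\<forall>x\<in>pverts H. \<forall>y\<in>pverts H. (f x, f y) \<in> parcs G \<longleftrightarrow> (x, y) \<in> parcs H)"
proof -
  \<comment> \<open>Since arcs join vertices and \<open>f\<close> is injective there, equality of
    arc images amounts to preserving adjacency in both directions, the form verified case by case
    later.\<close>
  have "map_prod f f ` parcs H = parcs G \<longleftrightarrow>
      (\<forall>x\<in>pverts H. \<forall>y\<in>pverts H. (f x, f y) \<in> parcs G \<longleftrightarrow> (x, y) \<in> parcs H)"
    if inj: "inj_on f (pverts H)" and im: "f ` pverts H = pverts G"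
  proof
    assume eq: "map_prod f f ` parcs H = parcs G"
    show "\<forall>x\<in>pverts H. \<forall>y\<in>pverts H. (f x, f y) \<in> parcs G \<longleftrightarrow> (x, y) \<in> parcs H"
    proof (intro ballI iffI)
      fix x y assume xy: "x \<in> pverts H" "y \<in> pverts H" "(f x, f y) \<in> parcs G"
      then obtain a b where "(a, b) \<in> parcs H" "f x = f a" "f y = f b" using eq by force
      then show "(x, y) \<in> parcs H" using inj xy assms(1) by (metis inj_onD mem_Sigma_iff subsetD)
    qed (use eq in force)
  next
    assume iff: "\<forall>x\<in>pverts H. \<forall>y\<in>pverts H. (f x, f y) \<in> parcs G \<longleftrightarrow> (x, y) \<in> parcs H"
    show "map_prod f f ` parcs H = parcs G"
    proof (intro subset_antisym subsetI)
      fix e assume "e \<in> parcs G"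
      moreover from this obtain x y where "e = (f x, f y)" "x \<in> pverts H" "y \<in> pverts H"
        using assms(2) im by (cases e) blast
      ultimately show "e \<in> map_prod f f ` parcs H" using iff by force
    qed (use iff assms(1) in auto)
  qed
  moreover have "map_graph f H = G \<longleftrightarrow> f ` pverts H = pverts G \<and> map_prod f f ` parcs H = parcs G"
    by (cases G) (auto simp: map_graph_def)
  ultimately show ?thesis unfolding graph_iso_def by blast
qed

lemma disjoint_union_simps [simp]:
  "pverts (disjoint_union I H) = (SIGMA i:I. pverts (H i))"
  "((i, x), (j, y)) \<in> parcs (disjoint_union I H) \<longleftrightarrow> i \<in> I \<and> i = j \<and> (x, y) \<in> parcs (H i)"
  by (auto simp: disjoint_union_def)

lemma parcs_join_disjoint_union_subset:
  fixes s :: nat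
  assumes "\<And>i. i \<in> I \<Longrightarrow> parcs (H i) \<subseteq> pverts (H i) \<times> pverts (H i)"
  defines "J \<equiv> graph_join (K_graph s) (disjoint_union I H)"
  shows "parcs J \<subseteq> pverts J \<times> pverts J"
proof
  fix e assume "e \<in> parcs J"
  moreover obtain a b where "e = (a, b)" by (cases e)
  ultimately show "e \<in> pverts J \<times> pverts J"
    unfolding J_def by (cases a; cases b) (auto intro!: imageI dest: subsetD[OF assms(1)])
qed

section \<open>The join decomposition\<close>

lemma rtrancl_map_graph:
  "(x, y) \<in> (parcs H)\<^sup>* \<Longrightarrow> (f x, f y) \<in> (parcs (map_graph f H))\<^sup>*"
  by (induction rule: rtrancl_induct)
    (auto simp: map_graph_def intro: rtrancl_into_rtrancl rev_image_eqI)

lemma join_decomposition_exists: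
  fixes C :: "nat \<Rightarrow> 'a pair_pre_digraph"
  assumes simple: "simple_graph G" and nonempty: "pverts G - universal_verts G \<noteq> {}"
    and comps: "bij_betw C {1..r} (components (del_verts G (universal_verts G)))"
  shows "\<exists>f. graph_iso f (graph_join (K_graph (card (universal_verts G))) (disjoint_union {1..r} C)) G \<and>
    (\<forall>j\<in>{1..r}. \<forall>v\<in>pverts (C j). f (Inr (j, v)) = v)"
proof -
  note G = simple_graphD[OF simple] and univ = mem_universal_verts_iff[OF simple]
  let ?U = "universal_verts G" and ?W = "pverts G - universal_verts G"
  let ?s = "card ?U"
  let ?D = "induced G ?W" and ?J = "graph_join (K_graph ?s) (disjoint_union {1..r} C)"
  have simpleD: "simple_graph ?D"
    by (rule simple_graph_induced[OF simple _ nonempty]) auto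
  have comp: "C j \<in> components ?D" if "j \<in> {1..r}" for j
    using bij_betwE[OF comps] that by (simp add: del_verts_eq_induced)
  note c = componentsD[OF simpleD comp]
  have verts: "(\<Union>j\<in>{1..r}. pverts (C j)) = ?W"
    using Union_components[OF simpleD] bij_betw_imp_surj_on[OF comps]
    by (simp add: del_verts_eq_induced flip: UN_simps(10))
  have parcsC: "parcs (C j) = parcs G \<inter> pverts (C j) \<times> pverts (C j)" if "j \<in> {1..r}" for j
    using arg_cong[OF c(1)[OF that], of parcs] c(2)[OF that] by auto
  have same: "i = j" if "i \<in> {1..r}" "j \<in> {1..r}" "x \<in> pverts (C i)" "x \<in> pverts (C j)" for i j x
    using components_eq_if_common_vertex[OF simpleD comp comp, of i j x] that
      bij_betw_imp_inj_on[OF comps] by (auto dest: inj_onD)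
  have "finite ?U" using G(1) univ by (auto intro: finite_subset)
  then obtain g where g: "bij_betw g {..<?s} ?U"
    using ex_bij_betw_nat_finite[of ?U] by (auto simp: atLeast0LessThan)
  \<comment> \<open>\<open>g\<close> enumerates the universal vertices in any order; on the
    components \<open>f\<close> forgets the index, so each of them is embedded identically.\<close>
  define f :: "nat + nat \<times> 'a \<Rightarrow> 'a" where "f = case_sum g snd"
  have f [simp]: "f (Inl i) = g i" "f (Inr (j, v)) = v" for i j v by (simp_all add: f_def)
  have gU: "g i \<in> ?U" if "i < ?s" for i using bij_betwE[OF g] that by auto
  have g_eq: "g i = g j \<longleftrightarrow> i = j" if "i < ?s" "j < ?s" for i j
    using bij_betw_imp_inj_on[OF g] that by (auto dest: inj_onD)
  have CW: "x \<in> pverts G \<and> x \<notin> ?U" if "j \<in> {1..r}" "x \<in> pverts (C j)" for j x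
    using verts that by blast
  have adj: "(g i, x) \<in> parcs G \<and> (x, g i) \<in> parcs G" if "i < ?s" "x \<in> pverts G" "x \<noteq> g i" for i x
    using gU[OF that(1)] that univ symD[OF G(4)] by blast
  have "inj_on f (pverts ?J)"
  proof (rule inj_onI)
    fix a b assume ab: "a \<in> pverts ?J" "b \<in> pverts ?J" "f a = f b"
    show "a = b"
    proof (cases a; cases b)
      fix i j assume "a = Inl i" "b = Inl j"
      then show ?thesis using ab g_eq by auto
    next
      fix i q assume "a = Inl i" "b = Inr q"
      then show ?thesis using ab gU CW by (cases q) fastforce
    next
      fix p j assume "a = Inr p" "b = Inl j"
      then show ?thesis using ab gU CW by (cases p) fastforce
    next
      fix p q assume "a = Inr p" "b = Inr q"
      moreover obtain i x j y where "p = (i, x)" "q = (j, y)" by (cases p; cases q)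
      ultimately show ?thesis using ab same[of i j x] by auto
    qed
  qed
  moreover have "f ` pverts ?J = pverts G"
  proof -
    have "f ` pverts ?J = g ` {..<?s} \<union> (\<Union>j\<in>{1..r}. pverts (C j))"
      by (force simp: image_Un image_image)
    also have "g ` {..<?s} = ?U" using g by (rule bij_betw_imp_surj_on)
    finally show ?thesis using verts univ by auto
  qed
  moreover have "(f a, f b) \<in> parcs G \<longleftrightarrow> (a, b) \<in> parcs ?J"
    if ab: "a \<in> pverts ?J" "b \<in> pverts ?J" for a b
  proof (cases a; cases b)
    fix i j assume "a = Inl i" "b = Inl j"
    then show ?thesis using ab adj[of i "g j"] gU univ g_eq G(5) by auto
  next
    fix i q assume "a = Inl i" "b = Inr q"
    then show ?thesis using ab adj gU CW by (cases q) fastforce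
  next
    fix p j assume "a = Inr p" "b = Inl j"
    then show ?thesis using ab adj gU CW by (cases p) fastforce
  next
    fix p q assume eq: "a = Inr p" "b = Inr q"
    obtain i x j y where pq: "p = (i, x)" "q = (j, y)" by (cases p; cases q)
    have i: "i \<in> {1..r}" "x \<in> pverts (C i)" and j: "j \<in> {1..r}" "y \<in> pverts (C j)"
      using ab eq pq by auto
    \<comment> \<open>Components of \<open>?D\<close> are closed under its edges, so adjacent
      vertices outside \<open>?U\<close> share a component.\<close>
    have "i = j" if "(x, y) \<in> parcs G"
      using c(4)[OF i(1) i(2), of y] that CW[OF i] CW[OF j] same[OF i(1) j(1) _ j(2)] by auto
    then show ?thesis using eq pq i j parcsC by auto
  qed
  moreover have "parcs ?J \<subseteq> pverts ?J \<times> pverts ?J"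
    by (rule parcs_join_disjoint_union_subset) (use parcsC in blast)
  ultimately have "graph_iso f ?J G" using graph_iso_iff[of ?J G f] G(3) by simp
  then show ?thesis by auto
qed

text \<open>The image of \<open>K_s\<close> must be the set of universal vertices. The rest then
  consists of connected images of the \<open>H j\<close> without edges between them, and these are
  the components.\<close>

lemma join_decomposition_unique:
  fixes C :: "nat \<Rightarrow> 'a pair_pre_digraph" and H :: "nat \<Rightarrow> 'b pair_pre_digraph"
  assumes simple: "simple_graph G" and incomplete: "\<not> complete_graph G"
    and comps: "bij_betw C {1..r} (components (del_verts G (universal_verts G)))"
    and iso: "graph_iso f (graph_join (K_graph s) (disjoint_union {1..r'} H)) G"
    and H: "\<And>j. j \<in> {1..r'} \<Longrightarrow> complete_graph (H j) \<or> (\<exists>t>0. H j \<in> N_class t)"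
  shows "s = card (universal_verts G)"
    and "\<exists>p. bij_betw p {1..r'} {1..r} \<and>
      (\<forall>j\<in>{1..r'}. map_graph (\<lambda>v. f (Inr (j, v))) (H j) = C (p j))"
proof -
  note G = simple_graphD[OF simple] and univ = mem_universal_verts_iff[OF simple]
  let ?U = "universal_verts G" and ?W = "pverts G - universal_verts G"
  let ?D = "induced G ?W" and ?J = "graph_join (K_graph s) (disjoint_union {1..r'} H)"
  have nonempty: "?W \<noteq> {}" by (rule exists_not_universal[OF simple incomplete])
  have simpleD: "simple_graph ?D"
    by (rule simple_graph_induced[OF simple _ nonempty]) auto
  have simpleH: "simple_graph (H j)" if "j \<in> {1..r'}" for j
    using H[OF that] simple_graph_complete by (auto simp: N_class_def M_class_def)
  have connH: "(x, y) \<in> (parcs (H j))\<^sup>*"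
    if "j \<in> {1..r'}" "x \<in> pverts (H j)" "y \<in> pverts (H j)" for j x y
    using H[OF that(1)]
  proof
    assume "complete_graph (H j)"
    then show ?thesis using that by (cases "x = y") (auto simp: complete_graph_iff)
  next
    assume "\<exists>t>0. H j \<in> N_class t"
    then show ?thesis using that connected_iff[OF simpleH[OF that(1)]] by (auto simp: N_class_def)
  qed
  have "parcs ?J \<subseteq> pverts ?J \<times> pverts ?J"
    by (rule parcs_join_disjoint_union_subset) (use simple_graphD(3)[OF simpleH] in blast)
  then have inj: "inj_on f (pverts ?J)" and im: "f ` pverts ?J = pverts G"
    and iff: "\<And>x y. x \<in> pverts ?J \<Longrightarrow> y \<in> pverts ?J \<Longrightarrow> (f x, f y) \<in> parcs G \<longleftrightarrow> (x, y) \<in> parcs ?J"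
    using iso graph_iso_iff[of ?J G f] G(3) by auto
  let ?S = "\<lambda>j. (\<lambda>v. f (Inr (j, v))) ` pverts (H j)"
  have V: "pverts G = (\<lambda>i. f (Inl i)) ` {..<s} \<union> (\<Union>j\<in>{1..r'}. ?S j)"
    unfolding im[symmetric] by (force simp: image_Un image_image)
  have f_eq: "f a = f b \<longleftrightarrow> a = b" if "a \<in> pverts ?J" "b \<in> pverts ?J" for a b
    using inj that by (auto dest: inj_onD)
  have U: "?U = (\<lambda>i. f (Inl i)) ` {..<s}"
  proof (intro subset_antisym subsetI)
    fix v assume "v \<in> (\<lambda>i. f (Inl i)) ` {..<s}"
    then obtain i where i: "i < s" "v = f (Inl i)" by auto
    have "(f (Inl i), f b) \<in> parcs G" if "b \<in> pverts ?J" "b \<noteq> Inl i" for b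
      using that i(1) by (subst iff) (cases b; auto)+
    then have "\<forall>x\<in>pverts G. x \<noteq> v \<longrightarrow> (v, x) \<in> parcs G" unfolding im[symmetric] i(2) by auto
    moreover have "v \<in> pverts G" unfolding im[symmetric] i(2) using i(1) by auto
    ultimately show "v \<in> ?U" using univ by blast
  next
    fix v assume v: "v \<in> ?U"
    show "v \<in> (\<lambda>i. f (Inl i)) ` {..<s}"
    proof (rule ccontr)
      \<comment> \<open>A universal vertex inside some \<open>H j\<close> forbids any other part and
        is universal in \<open>H j\<close>. Members of \<open>N_class\<close> have none, so
        \<open>H j\<close> is complete, and then so is \<open>G\<close>.\<close>
      assume "v \<notin> (\<lambda>i. f (Inl i)) ` {..<s}"
      then obtain j x where jx: "j \<in> {1..r'}" "x \<in> pverts (H j)" "v = f (Inr (j, x))"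
        using v univ V by blast
      have adj: "(Inr (j, x), b) \<in> parcs ?J" if "b \<in> pverts ?J" "b \<noteq> Inr (j, x)" for b
      proof -
        have "f b \<in> pverts G" using im that by blast
        moreover have "f b \<noteq> v" using f_eq[OF that(1), of "Inr (j, x)"] that jx by auto
        ultimately have "(v, f b) \<in> parcs G" using v univ by blast
        then show ?thesis using iff[of "Inr (j, x)" b] that(1) jx by auto
      qed
      have only: "k = j" if k: "k \<in> {1..r'}" for k
      proof (rule ccontr)
        assume "k \<noteq> j"
        obtain y where "y \<in> pverts (H k)" using simple_graphD(2)[OF simpleH[OF k]] by blast
        then show False using adj[of "Inr (k, y)"] \<open>k \<noteq> j\<close> k by auto
      qed
      have "x \<in> universal_verts (H j)"
        unfolding mem_universal_verts_iff[OF simpleH[OF jx(1)]]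
      proof (intro conjI ballI impI)
        fix y assume y: "y \<in> pverts (H j)" "y \<noteq> x"
        then have "(Inr (j, x), Inr (j, y)) \<in> parcs ?J"
          using jx(1) by (intro adj) auto
        then show "(x, y) \<in> parcs (H j)" by simp
      qed (rule jx(2))
      then have "complete_graph (H j)" using H[OF jx(1)] by (auto simp: N_class_def)
      then have Hj: "parcs (H j) = {(u, v). u \<in> pverts (H j) \<and> v \<in> pverts (H j) \<and> u \<noteq> v}"
        by (simp add: complete_graph_iff)
      have "{1..r'} = {j}" using only jx(1) by blast
      then have adj': "(a, b) \<in> parcs ?J" if "a \<in> pverts ?J" "b \<in> pverts ?J" "a \<noteq> b" for a b
        using that Hj by (cases a; cases b) auto
      have "(f a, f b) \<in> parcs G" if "a \<in> pverts ?J" "b \<in> pverts ?J" "f a \<noteq> f b" for a b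
        using iff[OF that(1,2)] adj'[OF that(1,2)] that(3) by auto
      then have "complete_graph G"
        using G unfolding complete_graph_iff im[symmetric] by auto
      then show False using incomplete by simp
    qed
  qed
  have "inj_on (\<lambda>i. f (Inl i)) {..<s}" by (rule inj_onI) (simp add: f_eq)
  then show "s = card ?U" unfolding U by (simp add: card_image)
  have S_sub: "?S j \<inter> ?U = {}" "?S j \<subseteq> pverts G" if "j \<in> {1..r'}" for j
    using that by (auto simp: U V f_eq)
  have W: "?W = (\<Union>j\<in>{1..r'}. ?S j)" using S_sub(1) unfolding U V by blast
  define q where "q j = map_graph (\<lambda>v. f (Inr (j, v))) (H j)" for j
  have pverts_q: "pverts (q j) = ?S j" for j by (simp add: q_def map_graph_def)
  have parcsD: "(f (Inr (j, x)), f (Inr (k, y))) \<in> parcs ?D \<longleftrightarrow> j = k \<and> (x, y) \<in> parcs (H j)"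
    if "j \<in> {1..r'}" "k \<in> {1..r'}" "x \<in> pverts (H j)" "y \<in> pverts (H k)" for j k x y
  proof -
    have "f (Inr (j, x)) \<in> ?W" "f (Inr (k, y)) \<in> ?W" using that W by blast+
    then show ?thesis using iff[of "Inr (j, x)" "Inr (k, y)"] that by auto
  qed
  have parcs_q: "parcs (q j) = parcs ?D \<inter> ?S j \<times> ?S j" if j: "j \<in> {1..r'}" for j
  proof (intro subset_antisym subsetI)
    fix e assume "e \<in> parcs (q j)"
    then obtain x y where "e = (f (Inr (j, x)), f (Inr (j, y)))" "(x, y) \<in> parcs (H j)"
      by (auto simp: q_def map_graph_def)
    then show "e \<in> parcs ?D \<inter> ?S j \<times> ?S j"
      using parcsD[of j j x y] j simple_graphD(3)[OF simpleH[OF j]] by blast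
  next
    fix e assume e: "e \<in> parcs ?D \<inter> ?S j \<times> ?S j"
    then obtain x y where "e = (f (Inr (j, x)), f (Inr (j, y)))" "x \<in> pverts (H j)" "y \<in> pverts (H j)"
      by blast
    then show "e \<in> parcs (q j)"
      using e parcsD[of j j x y] j by (auto simp: q_def map_graph_def)
  qed
  have q_comp: "q j \<in> components ?D" if j: "j \<in> {1..r'}" for j
  proof -
    have "induced ?D (?S j) \<in> components ?D"
    proof (rule in_componentsI[OF simpleD])
      show "?S j \<subseteq> pverts ?D" using W j by auto
      show "?S j \<noteq> {}" using simple_graphD(2)[OF simpleH[OF j]] by simp
    next
      fix a b assume "a \<in> ?S j" "(a, b) \<in> parcs ?D"
      moreover from this obtain k y where "k \<in> {1..r'}" "y \<in> pverts (H k)" "b = f (Inr (k, y))"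
        using W by fastforce
      ultimately show "b \<in> ?S j" using parcsD[OF j, of k _ y] by blast
    next
      fix a b assume "a \<in> ?S j" "b \<in> ?S j"
      then have "(a, b) \<in> (parcs (q j))\<^sup>*"
        using connH[OF j] unfolding q_def by (auto intro: rtrancl_map_graph[of _ _ "H j"])
      then show "(a, b) \<in> (parcs ?D)\<^sup>*"
        using rtrancl_mono[of "parcs (q j)" "parcs ?D"] parcs_q[OF j] by blast
    qed
    moreover have "q j = induced ?D (?S j)"
      using pverts_q parcs_q[OF j] by (intro pair_pre_digraph.equality) auto
    ultimately show ?thesis by simp
  qed
  have "inj_on q {1..r'}"
  proof (rule inj_onI)
    fix j k assume jk: "j \<in> {1..r'}" "k \<in> {1..r'}" "q j = q k"
    then obtain x where x: "x \<in> pverts (H j)" using simple_graphD(2)[OF simpleH] by blast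
    then have "f (Inr (j, x)) \<in> ?S k" using jk(3) pverts_q[of j] pverts_q[of k] by auto
    then obtain y where "y \<in> pverts (H k)" "f (Inr (j, x)) = f (Inr (k, y))" by blast
    then show "j = k" using f_eq[of "Inr (j, x)" "Inr (k, y)"] jk x by auto
  qed
  moreover have "q ` {1..r'} = components ?D"
  proof (intro subset_antisym subsetI)
    fix K assume K: "K \<in> components ?D"
    then obtain v where v: "v \<in> pverts K" "v \<in> ?W" using componentsD(2,3)[OF simpleD K] by auto
    then obtain j where j: "j \<in> {1..r'}" "v \<in> pverts (q j)" using W pverts_q by blast
    then have "K = q j" using components_eq_if_common_vertex[OF simpleD K q_comp] v by blast
    then show "K \<in> q ` {1..r'}" using j by blast
  qed (use q_comp in blast)
  ultimately have q: "bij_betw q {1..r'} (components ?D)" by (simp add: bij_betw_def)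
  have comps': "bij_betw C {1..r} (components ?D)" using comps by (simp add: del_verts_eq_induced)
  \<comment> \<open>Both \<open>q\<close> and \<open>C\<close> enumerate the components, so the
    reindexing sends \<open>j\<close> to the index under \<open>C\<close> of the component
    \<open>q j\<close>.\<close>
  have "bij_betw (inv_into {1..r} C \<circ> q) {1..r'} {1..r}"
    by (rule bij_betw_trans[OF q bij_betw_inv_into[OF comps']])
  moreover have "C ((inv_into {1..r} C \<circ> q) j) = q j" if "j \<in> {1..r'}" for j
    using bij_betw_inv_into_right[OF comps' q_comp[OF that]] by simp
  ultimately show "\<exists>p. bij_betw p {1..r'} {1..r} \<and>
      (\<forall>j\<in>{1..r'}. map_graph (\<lambda>v. f (Inr (j, v))) (H j) = C (p j))"
    unfolding q_def[symmetric] by (intro exI[of _ "inv_into {1..r} C \<circ> q"] conjI ballI) auto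
qed

section \<open>The components of a critical graph\<close>

lemma component_card_ge_3:
  assumes "simple_graph G" "H \<in> components G" "\<not> complete_graph H"
  shows "card (pverts H) \<ge> 3"
proof -
  note H = simple_graphD[OF simple_graph_component[OF assms(1,2)]]
  obtain u v where uv: "u \<in> pverts H" "v \<in> pverts H" "u \<noteq> v" "(u, v) \<notin> parcs H"
    using assms(3) H unfolding complete_graph_iff by auto
  \<comment> \<open>The first step of a walk from \<open>u\<close> to the non-adjacent vertex
    \<open>v\<close> leads to a third vertex.\<close>
  then obtain z where z: "(u, z) \<in> parcs H"
    using componentsD(5)[OF assms(1,2)] by (metis converse_rtranclE)
  then have "z \<noteq> u" "z \<noteq> v" using uv H(5) by auto
  then have "{u, v, z} \<subseteq> pverts H" "card {u, v, z} = 3" using z uv H(3) by auto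
  then show ?thesis using card_mono[OF H(1)] by metis
qed

lemma M_class_components:
  fixes C :: "nat \<Rightarrow> 'a pair_pre_digraph"
  assumes M: "G \<in> M_class t" and t: "t > 0"
    and comps: "bij_betw C {1..r} (components (del_verts G (universal_verts G)))"
  shows "t + card (universal_verts G) = (\<Sum>j=1..r. mu (C j) + i_H (C j))"
    and "j \<in> {1..r} \<Longrightarrow> complete_graph (C j) \<and> mu (C j) = 0 \<or>
      mu (C j) > 0 \<and> C j \<in> N_class (mu (C j))"
proof -
  have simple: "simple_graph G" using M by (simp add: M_class_def)
  note G = simple_graphD[OF simple] and univ = mem_universal_verts_iff[OF simple]
  let ?U = "universal_verts G" and ?W = "pverts G - universal_verts G"
  let ?D = "induced G ?W"
  have nonempty: "?W \<noteq> {}"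
    by (rule exists_not_universal[OF simple not_complete_if_M_class[OF M t]])
  have simpleD: "simple_graph ?D"
    by (rule simple_graph_induced[OF simple _ nonempty]) auto
  have comp: "C j \<in> components ?D" if "j \<in> {1..r}" for j
    using bij_betwE[OF comps] that by (simp add: del_verts_eq_induced)
  note c = componentsD[OF simpleD comp] and simpleC = simple_graph_component[OF simpleD comp]
  have verts: "(\<Union>j\<in>{1..r}. pverts (C j)) = ?W"
    using Union_components[OF simpleD] bij_betw_imp_surj_on[OF comps]
    by (simp add: del_verts_eq_induced flip: UN_simps(10))
  have same: "i = j" if "i \<in> {1..r}" "j \<in> {1..r}" "x \<in> pverts (C i)" "x \<in> pverts (C j)" for i j x
    using components_eq_if_common_vertex[OF simpleD comp comp, of i j x] that
      bij_betw_imp_inj_on[OF comps] by (auto dest: inj_onD)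
  note pn = M_class_delete_universal[OF M t]
  have pnD: "path_number (parcs ?D) ?W = t + card ?U"
    unfolding pn(1)[symmetric] by (rule path_number_cong) simp
  have "path_number (parcs ?D) (\<Union>j\<in>{1..r}. pverts (C j)) =
      (\<Sum>j=1..r. path_number (parcs ?D) (pverts (C j)))"
  proof (rule path_number_UN)
    show "finite (pverts (C i))" if "i \<in> {1..r}" for i
      using simple_graphD(1)[OF simpleC[OF that]] .
    show "pverts (C i) \<inter> pverts (C j) = {}" if "i \<in> {1..r}" "j \<in> {1..r}" "i \<noteq> j" for i j
      using same that by blast
    show "(a, b) \<notin> parcs ?D" if "i \<in> {1..r}" "j \<in> {1..r}" "i \<noteq> j" "a \<in> pverts (C i)"
      "b \<in> pverts (C j)" for i j a b
      using c(4)[OF that(1,4)] same[OF that(1,2) _ that(5)] that(3) by blast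
  qed simp
  also have "\<dots> = (\<Sum>j=1..r. mu (C j) + i_H (C j))"
  proof (rule sum.cong)
    fix j assume j: "j \<in> {1..r}"
    have "path_number (parcs ?D) (pverts (C j)) = path_number (parcs (C j)) (pverts (C j))"
      by (rule path_number_cong) (use arg_cong[OF c(1)[OF j], of parcs] in auto)
    then show "path_number (parcs ?D) (pverts (C j)) = mu (C j) + i_H (C j)"
      using mu_add_i_H[OF simpleC[OF j]] by simp
  qed simp
  finally show sum: "t + card ?U = (\<Sum>j=1..r. mu (C j) + i_H (C j))"
    using verts pnD by simp
  assume j: "j \<in> {1..r}"
  show "complete_graph (C j) \<and> mu (C j) = 0 \<or> mu (C j) > 0 \<and> C j \<in> N_class (mu (C j))"
  proof (cases "complete_graph (C j)")
    case True
    then show ?thesis using mu_complete by blast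
  next
    case incomplete: False
    show ?thesis
    proof (cases "t + card ?U \<ge> 2")
      \<comment> \<open>A positive path number of 1 cannot drop, so the argument through criticality
        of \<open>?D\<close> fails here. Each component contributes at least 1 to the sum, hence
        there is only one, and it is \<open>G\<close>.\<close>
      case False
      then have "card ?U = 0" and t1: "t = 1" using t by auto
      then have U: "?U = {}" using G(1) univ by (metis (no_types) card_0_eq finite_subset subsetI)
      have "r = 1"
      proof (rule ccontr)
        assume "r \<noteq> 1"
        then have "2 \<le> r" using j by auto
        have "mu (C i) + i_H (C i) \<ge> 1" if "i \<in> {1..r}" for i
          using mu_add_i_H[OF simpleC[OF that]] simple_graphD(1,2)[OF simpleC[OF that]]
            path_number_pos[of "pverts (C i)" "parcs (C i)"] by simp
        then have "(\<Sum>i=1..r. 1) \<le> (\<Sum>i=1..r. mu (C i) + i_H (C i))" by (rule sum_mono)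
        then show False using sum \<open>2 \<le> r\<close> False by simp
      qed
      then have "j = 1" using j by simp
      then have "pverts (C j) = pverts G" using verts \<open>r = 1\<close> U by simp
      then have "C j = induced G (pverts G)" using c(1)[OF j] U by (simp add: induced_def)
      then have "C j = G" using G(3) by (intro pair_pre_digraph.equality) auto
      moreover have "Digraph_Component.connected (with_proj (C j))"
        using connected_iff[OF simpleC[OF j]] c(5)[OF j] by blast
      ultimately show ?thesis using M t U by (auto simp: N_class_def M_class_def)
    next
      case True
      have "card (pverts (C j)) \<le> card ?W"
        using c(2)[OF j] G(1) by (intro card_mono) auto
      then have card: "card ?W \<ge> 3" using component_card_ge_3[OF simpleD comp[OF j] incomplete] by simp
      have crit: "path_number (parcs ?D \<union> {(u, v), (v, u)}) (pverts ?D) <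
          path_number (parcs ?D) (pverts ?D)"
        if uv: "u \<in> pverts ?D" "v \<in> pverts ?D" "u \<noteq> v" "(u, v) \<notin> parcs ?D" for u v
      proof -
        \<comment> \<open>A Hamiltonian cycle using the new edge would leave a single path through
          \<open>?W\<close> without it, while at least two paths are needed.\<close>
        have "\<not> (?U = {} \<and> ham (parcs G \<union> {(u, v), (v, u)}) ?W)"
          using path_cover_of_ham_insert_edge[OF _ card _ G(4), of u v] uv(1) G(1)
            path_cover_iff[of ?W "parcs G" 1] pn(1) True by auto
        then have "path_number (parcs G \<union> {(u, v), (v, u)}) ?W < t + card ?U"
          using pn(2)[of u v] uv by auto
        moreover have "path_number (parcs ?D \<union> {(u, v), (v, u)}) ?W =
            path_number (parcs G \<union> {(u, v), (v, u)}) ?W"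
          by (rule path_number_cong) simp
        ultimately show ?thesis using pnD by simp
      qed
      \<comment> \<open>The deleted vertices are adjacent to everything, so a universal vertex of
        \<open>?D\<close> would be universal in \<open>G\<close> and hence already deleted.\<close>
      have "v \<notin> universal_verts ?D" for v
      proof
        assume "v \<in> universal_verts ?D"
        then have v: "v \<in> ?W" "\<And>x. x \<in> ?W \<Longrightarrow> x \<noteq> v \<Longrightarrow> (v, x) \<in> parcs G"
          by (simp_all add: mem_universal_verts_iff[OF simpleD])
        moreover have "(v, x) \<in> parcs G" if "x \<in> ?U" for x
        proof -
          have "v \<noteq> x" using that v(1) by blast
          then have "(x, v) \<in> parcs G" using that v(1) univ[of x] by simp
          then show ?thesis by (rule symD[OF G(4)])
        qed
        ultimately have "v \<in> ?U" unfolding univ[of v] by blast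
        then show False using v(1) by simp
      qed
      then show ?thesis
        using component_in_N_class[OF simpleD _ comp[OF j] incomplete crit] by blast
    qed
  qed
qed

theorem theorem3p4:
  fixes G :: "'a pair_pre_digraph" and C :: "nat \<Rightarrow> 'a pair_pre_digraph"
    and t s r :: nat
  assumes "t > 0"
    and "G \<in> M_class t"
    and "s = card (universal_verts G)"
    and "bij_betw C {1..r} (components (del_verts G (universal_verts G)))"
  shows "(\<exists>f. graph_iso f (graph_join (K_graph s) (disjoint_union {1..r} C)) G \<and>
              (\<forall>j\<in>{1..r}. \<forall>v\<in>pverts (C j). f (Inr (j, v)) = v))
    \<and> (\<forall>s' r' (H :: nat \<Rightarrow> 'b pair_pre_digraph) f.
         graph_iso f (graph_join (K_graph s') (disjoint_union {1..r'} H)) G \<and>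
         (\<forall>j\<in>{1..r'}. complete_graph (H j) \<or> (\<exists>t'>0. H j \<in> N_class t')) \<longrightarrow>
         s' = s \<and>
         (\<exists>p. bij_betw p {1..r'} {1..r} \<and>
              (\<forall>j\<in>{1..r'}. map_graph (\<lambda>v. f (Inr (j, v))) (H j) = C (p j))))
    \<and> (\<forall>j\<in>{1..r}. (complete_graph (C j) \<and> mu (C j) = 0) \<or>
                   (mu (C j) > 0 \<and> C j \<in> N_class (mu (C j))))
    \<and> int t = (\<Sum>j=1..r. int (mu (C j))) + (\<Sum>j=1..r. int (i_H (C j))) - int s"
proof (intro conjI)
  have simple: "simple_graph G" using assms(2) by (simp add: M_class_def)
  have incomplete: "\<not> complete_graph G" using not_complete_if_M_class assms(1,2) by blast
  show "\<exists>f. graph_iso f (graph_join (K_graph s) (disjoint_union {1..r} C)) G \<and>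
      (\<forall>j\<in>{1..r}. \<forall>v\<in>pverts (C j). f (Inr (j, v)) = v)"
    unfolding assms(3)
    by (rule join_decomposition_exists[OF simple exists_not_universal[OF simple incomplete] assms(4)])
  show "\<forall>s' r' (H :: nat \<Rightarrow> 'b pair_pre_digraph) f.
      graph_iso f (graph_join (K_graph s') (disjoint_union {1..r'} H)) G \<and>
      (\<forall>j\<in>{1..r'}. complete_graph (H j) \<or> (\<exists>t'>0. H j \<in> N_class t')) \<longrightarrow>
      s' = s \<and>
      (\<exists>p. bij_betw p {1..r'} {1..r} \<and>
        (\<forall>j\<in>{1..r'}. map_graph (\<lambda>v. f (Inr (j, v))) (H j) = C (p j)))"
    unfolding assms(3)
    using join_decomposition_unique[OF simple incomplete assms(4)] by blast
  show "\<forall>j\<in>{1..r}. (complete_graph (C j) \<and> mu (C j) = 0) \<or>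
      (mu (C j) > 0 \<and> C j \<in> N_class (mu (C j)))"
    using M_class_components(2)[OF assms(2,1,4)] by blast
  have "int (t + s) = (\<Sum>j=1..r. int (mu (C j))) + (\<Sum>j=1..r. int (i_H (C j)))"
    unfolding assms(3) M_class_components(1)[OF assms(2,1,4)] by (simp add: sum.distrib)
  then show "int t = (\<Sum>j=1..r. int (mu (C j))) + (\<Sum>j=1..r. int (i_H (C j))) - int s" by simp
qed

end
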